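(* Let $K$ and $K'$ be infinite Dirichlet fields. If the Golomb spaces $G(K[X])$ and $G(K'[X])$ are homeomorphic, then $K$ and $K'$ have the same characteristic.
   Context: For an integral domain $R$ (commutative unitary ring without zero-divisors), write $R^\bullet := R\setminus\{0\}$. The Golomb space $G(R)$ is the topological space with underlying set $R^\bullet$ whose topology (the Golomb topology) is generated by the sets $(a+I)\cap R^\bullet$, where $a\in R^\bullet$ and $I$ is a nonzero ideal of $R$ with $\langle a, I\rangle = R$. A field $K$ is called Dirichlet if the set of irreducible elements of the one-variable polynomial ring $K[X]$ is dense in $G(K[X])$. *)

theory Defs
  imports
    "HOL-Analysis.Analysis"
    "HOL-Computational_Algebra.Computational_Algebra"
begin

text \<open>Ideals of a commutative ring are the submodules of the ring over itself.\<close>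

lemma module_times: "module ((*) :: 'a::comm_ring_1 \<Rightarrow> 'a \<Rightarrow> 'a)"
  by unfold_locales (simp_all add: algebra_simps)

definition ring_ideal :: "'a::comm_ring_1 set \<Rightarrow> bool" where
  "ring_ideal = module.subspace (*)"

definition ideal_generated :: "'a::comm_ring_1 set \<Rightarrow> 'a set" where
  "ideal_generated = module.span (*)"

lemma ring_ideal_iff:
  "ring_ideal I \<longleftrightarrow> 0 \<in> I \<and> (\<forall>x\<in>I. \<forall>y\<in>I. x + y \<in> I) \<and> (\<forall>c. \<forall>x\<in>I. c * x \<in> I)"
  by (simp add: ring_ideal_def module.subspace_def[OF module_times])

definition golomb_topology :: "'a::idom topology" where
  "golomb_topology = topology_generated_by
     {(+) a ` I \<inter> (- {0}) | a I.
        a \<noteq> 0 \<and> ring_ideal I \<and> I \<noteq> {0} \<and> ideal_generated (insert a I) = UNIV}"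

lemma topspace_golomb_topology: "topspace (golomb_topology :: 'a::idom topology) = - {0}"
proof -
  have "ring_ideal (UNIV :: 'a set)"
    by (simp add: ring_ideal_iff)
  moreover have "ideal_generated (UNIV :: 'a set) = UNIV"
    unfolding ideal_generated_def
    using module.span_superset[OF module_times, of UNIV] by blast
  moreover have "(UNIV :: 'a set) \<noteq> {0}"
    using one_neq_zero by blast
  ultimately have "(+) 1 ` UNIV \<inter> (- {0}) \<in>
     {(+) a ` I \<inter> (- {0}) | a I :: 'a set.
        a \<noteq> 0 \<and> ring_ideal I \<and> I \<noteq> {0} \<and> ideal_generated (insert a I) = UNIV}"
    (is "_ \<in> ?B")
    unfolding mem_Collect_eq
    by (intro exI[of _ 1] exI[of _ UNIV]) simp
  then have "- {0 :: 'a} \<in> ?B"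
    by (simp only: surj_plus Int_UNIV_left)
  moreover have "\<Union>?B \<subseteq> - {0 :: 'a}"
    by blast
  ultimately have "\<Union>?B = - {0 :: 'a}"
    by blast
  then show ?thesis
    unfolding golomb_topology_def topology_generated_by_topspace .
qed

definition dirichlet_field :: "'a::field itself \<Rightarrow> bool" where
  "dirichlet_field _ \<longleftrightarrow>
     golomb_topology closure_of {p :: 'a poly. irreducible p}
       = topspace (golomb_topology :: 'a poly topology)"

end

theory Submission
  imports Defs
begin

text \<open>
  The inclusion of supports (sets of irreducible divisors) of two polynomials can be read off from
  closures of open sets, so a homeomorphism permutes the sets \<open>P\<close> of nonzero multiples of an
  irreducible \<open>p\<close>. Off \<open>P\<close>, the relatively clopen sets are exactly the \<open>p\<close>-adically clopen ones,
  and Dirichlet density identifies the clopen sets generated by the elements avoiding a family of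
  such sets \<open>P\<close> with the \<open>p\<close>-adically open submonoids containing the units. Hence the poset of these
  submonoids is a topological invariant. If the characteristic is a prime \<open>q\<close> and \<open>p = X\<close>, the
  relevant quotients are abelian \<open>q\<close>-groups, so an interval of height two that is not a chain is
  the subgroup lattice of \<open>(\<int>/q)\<^sup>2\<close> and has \<open>q + 1\<close> intermediate members. Conversely, for
  every \<open>p\<close> there are intervals with \<open>q + 1\<close> intermediate members, and in
  characteristic zero there is one with two, the subgroup lattice of \<open>\<int>/6\<close>.
\<close>

section \<open>Comaximal elements and the Golomb topology\<close>

text \<open>In \<open>K[X]\<close> only constants are invertible, so modulo a power of
  \<open>p\<close> an open submonoid need not give a subgroup: the powers of an element may never
  return to the constants. For \<open>p = X\<close> in characteristic \<open>q\<close> this cannot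
  happen, because the residue field is \<open>K\<close> itself: the constants absorb it, and the
  remaining one-units are \<open>q\<close>-torsion by Frobenius. A homeomorphism may send the
  multiples of \<open>X\<close> to those of an irreducible \<open>p\<close> with any residue field,
  so on the other side only the existence of one interval is used. It is built modulo
  \<open>p ^ 2\<close>, where \<open>1 + z * p\<close> multiplies as \<open>z\<close> adds.
  Infinitude of the field supplies a second nonzero residue when primes are recovered, and a
  constant outside the prime field when an interval of rank two is built. Six is the least order of
  a cyclic group with incomparable subgroups, and the resulting count two differs from
  \<open>q + 1\<close> for every prime \<open>q\<close>.\<close>

definition comax :: "'a::comm_ring_1 \<Rightarrow> 'a \<Rightarrow> bool" where
  "comax a b \<longleftrightarrow> (\<exists>r s. r * a + s * b = 1)"

lemma comaxI: "r * a + s * b = 1 \<Longrightarrow> comax a b"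
  by (auto simp: comax_def)

lemma comax_sym: "comax a b \<Longrightarrow> comax b a"
  unfolding comax_def by (metis add.commute)

lemma comax_one [simp]: "comax 1 a" "comax a 1"
  by (rule comaxI[of 1 _ 0]; simp) (rule comaxI[of 0 _ 1]; simp)

lemma comax_dvd: "comax a b \<Longrightarrow> c dvd a \<Longrightarrow> d dvd b \<Longrightarrow> comax c d"
  unfolding comax_def dvd_def by (metis mult.assoc mult.commute)

lemma comax_mult: assumes "comax a b" "comax a c" shows "comax a (b * c)"
proof -
  obtain r s where 1: "r * a + s * b = 1" using assms by (auto simp: comax_def)
  obtain t u where 2: "t * a + u * c = 1" using assms by (auto simp: comax_def)
  have "(r * a + s * b) * (t * a + u * c) = 1" using 1 2 by simp
  then have "(r * t * a + r * u * c + s * b * t) * a + (s * u) * (b * c) = 1"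
    by (simp add: algebra_simps)
  then show ?thesis by (rule comaxI)
qed

lemma comax_mult_left: "comax a c \<Longrightarrow> comax b c \<Longrightarrow> comax (a * b) c"
  by (meson comax_mult comax_sym)

lemma comax_power: "comax a b \<Longrightarrow> comax a (b ^ n)"
  by (induction n) (auto intro: comax_mult)

lemma comax_power_left: "comax a b \<Longrightarrow> comax (a ^ n) b"
  by (meson comax_power comax_sym)

lemma comax_cong: assumes "comax a x" "a dvd y - x" shows "comax a y"
proof -
  obtain r s where 1: "r * a + s * x = 1" using assms by (auto simp: comax_def)
  obtain k where k: "y = x + a * k" using assms by (metis diff_add_cancel dvd_def add.commute)
  have "(r - s * k) * a + s * y = r * a + s * x" by (simp add: k algebra_simps)
  then show ?thesis using 1 comaxI by metis
qed

lemma comax_self_dvd: "comax a b \<Longrightarrow> a dvd b \<Longrightarrow> a dvd 1"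
  unfolding comax_def by (metis dvd_add dvd_mult dvd_refl)

text \<open>The usual Bezout combination, shifted by \<open>f * g\<close> if it hits the forbidden
  value \<open>c\<close>. Since the space omits 0, most uses take \<open>c = 0\<close>.\<close>

lemma comax_CRT:
  fixes f g :: "'a::idom"
  assumes "comax f g" "f \<noteq> 0" "g \<noteq> 0"
  obtains w where "f dvd w - a" "g dvd w - b" "w \<noteq> c"
proof -
  obtain r s where 1: "r * f + s * g = 1" using assms by (auto simp: comax_def)
  define w where "w = r * f * b + s * g * a"
  have sg: "s * g = 1 - r * f" and rf: "r * f = 1 - s * g" using 1 by (simp_all add: algebra_simps)
  have "w - a = f * (r * (b - a))" unfolding w_def sg by (simp add: algebra_simps)
  then have wa: "f dvd w - a" by simp
  have "w - b = g * (s * (a - b))" unfolding w_def rf by (simp add: algebra_simps)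
  then have wb: "g dvd w - b" by simp
  show ?thesis
  proof (cases "w = c")
    case False then show ?thesis using that wa wb by blast
  next
    case True
    have "f dvd (w + f * g) - a" "g dvd (w + f * g) - b"
      using dvd_add[OF wa, of "f * g"] dvd_add[OF wb, of "f * g"] by (simp_all add: algebra_simps)
    moreover have "w + f * g \<noteq> c" using True assms by simp
    ultimately show ?thesis using that by blast
  qed
qed

section \<open>Bezout, irreducible divisors and coprime splittings in \<open>K[X]\<close>\<close>

lemma bezout_common_divisor:
  fixes a b :: "'a::euclidean_ring"
  shows "\<exists>d r s. d dvd a \<and> d dvd b \<and> d = r * a + s * b"
proof (induction "euclidean_size b" arbitrary: a b rule: less_induct)
  case less
  show ?case
  proof (cases "b = 0")
    case True
    then show ?thesis by (intro exI[of _ a] exI[of _ 1] exI[of _ 0]) simp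
  next
    case False
    then have "euclidean_size (a mod b) < euclidean_size b" by (rule mod_size_less)
    from less[OF this, of b] obtain d r s
      where d: "d dvd b" "d dvd a mod b" "d = r * b + s * (a mod b)" by blast
    have "d dvd a" using d dvd_mod_iff by blast
    moreover have "d = s * a + (r - s * (a div b)) * b"
      unfolding d(3) by (simp add: minus_div_mult_eq_mod[symmetric] algebra_simps)
    ultimately show ?thesis using d(1) by blast
  qed
qed

lemma not_comaxE:
  fixes a b :: "'a::euclidean_ring"
  assumes "\<not> comax a b"
  obtains d where "d dvd a" "d dvd b" "\<not> d dvd 1"
proof -
  obtain d r s where d: "d dvd a" "d dvd b" "d = r * a + s * b"
    using bezout_common_divisor[of a b] by blast
  have "\<not> d dvd 1"
  proof
    assume "d dvd 1"
    then obtain k where "1 = d * k" by auto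
    then have "(k * r) * a + (k * s) * b = 1" unfolding d(3) by (simp add: algebra_simps)
    then show False using assms comaxI by blast
  qed
  then show ?thesis using that d by blast
qed

lemma irreducible_comax_iff:
  fixes p a :: "'a::euclidean_ring"
  assumes "irreducible p"
  shows "comax p a \<longleftrightarrow> \<not> p dvd a"
proof
  assume "comax p a" then show "\<not> p dvd a" using comax_self_dvd assms by (auto simp: irreducible_def)
next
  assume n: "\<not> p dvd a"
  show "comax p a"
  proof (rule ccontr)
    assume "\<not> comax p a"
    then obtain d where d: "d dvd p" "d dvd a" "\<not> d dvd 1" by (rule not_comaxE)
    from d(1) obtain k where k: "p = d * k" by auto
    then have "k dvd 1" using assms d(3) by (auto simp: irreducible_def)
    then have "p dvd d" using k by (metis dvd_def mult.assoc mult.right_neutral)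
    then show False using d n dvd_trans by blast
  qed
qed

lemma irreducible_dvd_multD:
  fixes p a b :: "'a::euclidean_ring"
  assumes "irreducible p" "p dvd a * b" "\<not> p dvd a" 
  shows "p dvd b"
  using assms irreducible_comax_iff comax_mult by metis

lemma poly_unit_degree: "(d :: 'k::field poly) dvd 1 \<longleftrightarrow> d \<noteq> 0 \<and> degree d = 0"
  using is_unit_iff_degree[of d] by (cases "d = 0") auto

lemma ex_irreducible_dvd:
  fixes d :: "'k::field poly"
  assumes "d \<noteq> 0" "\<not> d dvd 1"
  obtains p where "irreducible p" "p dvd d"
  using assms
proof (induction "degree d" arbitrary: d thesis rule: less_induct)
  case less
  show ?case
  proof (cases "irreducible d")
    case True then show ?thesis using less.prems(1) dvd_refl by blast
  next
    case False
    then obtain a b where ab: "d = a * b" "\<not> a dvd 1" "\<not> b dvd 1"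
      using less.prems by (auto simp: irreducible_def)
    then have "a \<noteq> 0" "b \<noteq> 0" using less.prems by auto
    then have "degree a < degree d" using ab by (simp add: degree_mult_eq poly_unit_degree)
    then obtain p where "irreducible p" "p dvd a" using less.hyps[of a] \<open>a \<noteq> 0\<close> ab by blast
    then show ?thesis using less.prems(1) ab(1) by auto
  qed
qed

lemma not_comax_irreducibleE:
  fixes a b :: "'k::field poly"
  assumes "\<not> comax a b" "a \<noteq> 0"
  obtains p where "irreducible p" "p dvd a" "p dvd b"
proof -
  obtain d where d: "d dvd a" "d dvd b" "\<not> d dvd 1" using assms(1) by (rule not_comaxE)
  have "d \<noteq> 0" using d assms by auto
  then obtain p where "irreducible p" "p dvd d" using ex_irreducible_dvd d by blast
  then show ?thesis using that d dvd_trans by blast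
qed

text \<open>Peeling off non-unit common divisors with \<open>x\<close> lowers the degree. For
  \<open>x\<close> an irreducible \<open>p\<close>, the factor \<open>A\<close> of a modulus is
  neutralised by making a point divisible by it, whereas \<open>B\<close> is a genuine
  \<open>p\<close>-adic condition.\<close>

lemma comax_split:
  fixes f x :: "'k::field poly"
  assumes "f \<noteq> 0"
  obtains A B N where "f = A * B" "comax A x" "B dvd x ^ N"
  using assms
proof (induction "degree f" arbitrary: f thesis rule: less_induct)
  case less
  show ?case
  proof (cases "comax f x")
    case True then show ?thesis using less.prems(1)[of f 1 0] by simp
  next
    case False
    then obtain d where d: "d dvd f" "d dvd x" "\<not> d dvd 1" by (rule not_comaxE)
    obtain g where g: "f = d * g" using d by auto
    have nz: "d \<noteq> 0" "g \<noteq> 0" using g less.prems by auto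
    then have "degree g < degree f" using g d(3) by (simp add: degree_mult_eq poly_unit_degree)
    then obtain A B N where *: "g = A * B" "comax A x" "B dvd x ^ N"
      using less.hyps[of g] nz by blast
    have "d * B dvd x ^ Suc N" using d * by (simp add: mult_dvd_mono)
    moreover have "f = A * (d * B)" using g * by simp
    ultimately show ?thesis using less.prems(1) * by blast
  qed
qed

text \<open>The degree of \<open>d\<close> bounds the multiplicity of every non-unit
  \<open>q\<close> at once, so one exponent serves for all irreducible divisors of a
  modulus.\<close>

lemma power_not_dvd:
  fixes q d :: "'k::field poly"
  assumes "\<not> q dvd 1" "d \<noteq> 0" "degree d < n"
  shows "\<not> q ^ n dvd d"
proof
  assume a: "q ^ n dvd d"
  have "q \<noteq> 0" using a assms by (auto simp: power_0_left)
  then have "degree q \<ge> 1" using assms(1) by (simp add: poly_unit_degree Suc_leI)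
  then have "n \<le> degree (q ^ n)" by (simp add: degree_power_eq \<open>q \<noteq> 0\<close>)
  also have "\<dots> \<le> degree d" using a assms dvd_imp_degree_le by blast
  finally show False using assms by simp
qed

section \<open>Balls, open sets and closures in the Golomb topology\<close>

definition gball :: "'a::idom \<Rightarrow> 'a \<Rightarrow> 'a set" where
  "gball x f = {y. y \<noteq> 0 \<and> f dvd y - x}"

lemma gball_self: "x \<noteq> 0 \<Longrightarrow> x \<in> gball x f"
  by (simp add: gball_def)

lemma ideal_generated_insert:
  assumes "ring_ideal I"
  shows "ideal_generated (insert a I) = {r * a + i | r i. i \<in> I}"
proof -
  have "module.span (*) I = I" using assms unfolding ring_ideal_def
    by (simp add: module.span_eq_iff[OF module_times])
  then have "module.span (*) (insert a I) = {x. \<exists>k. x - k * a \<in> I}"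
    by (simp add: module.span_insert[OF module_times])
  also have "\<dots> = {r * a + i | r i. i \<in> I}"
  proof (intro set_eqI iffI)
    fix x assume "x \<in> {x. \<exists>k. x - k * a \<in> I}"
    then obtain k where "x - k * a \<in> I" by blast
    moreover have "x = k * a + (x - k * a)" by simp
    ultimately show "x \<in> {r * a + i | r i. i \<in> I}" by blast
  next
    fix x assume "x \<in> {r * a + i | r i. i \<in> I}"
    then obtain r i where "x = r * a + i" "i \<in> I" by blast
    then have "x - r * a \<in> I" by simp
    then show "x \<in> {x. \<exists>k. x - k * a \<in> I}" by blast
  qed
  finally show ?thesis unfolding ideal_generated_def .
qed

text \<open>Single moduli suffice in place of ideals: if \<open>1 = r * a + j\<close> with
  \<open>j \<in> I\<close> and \<open>x = a + i\<close>, then \<open>f = j - r * i\<close> lies in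
  \<open>I\<close> and satisfies \<open>f + r * x = 1\<close>.\<close>

lemma openin_golomb_iff:
  "openin (golomb_topology :: 'a::idom topology) U \<longleftrightarrow>
    (\<forall>x\<in>U. x \<noteq> 0 \<and> (\<exists>f. f \<noteq> 0 \<and> comax f x \<and> gball x f \<subseteq> U))" (is "_ \<longleftrightarrow> ?R U")
proof
  assume "openin (golomb_topology :: 'a topology) U"
  then have "generate_topology_on {(+) a ` I \<inter> (- {0}) | a I.
        a \<noteq> 0 \<and> ring_ideal I \<and> I \<noteq> {0} \<and> ideal_generated (insert a I) = UNIV} U"
    unfolding golomb_topology_def by (rule openin_topology_generated_by)
  then show "?R U"
  proof induction
    case Empty then show ?case by simp
  next
    case (Int a b)
    show ?case
    proof
      fix x assume x: "x \<in> a \<inter> b"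
      obtain f where f: "f \<noteq> 0" "comax f x" "gball x f \<subseteq> a" "x \<noteq> 0" using Int.IH(1) x by (meson IntE)
      obtain g where g: "g \<noteq> 0" "comax g x" "gball x g \<subseteq> b" using Int.IH(2) x by (meson IntE)
      have "gball x (f * g) \<subseteq> a \<inter> b"
      proof
        fix y assume "y \<in> gball x (f * g)"
        then have "y \<in> gball x f" "y \<in> gball x g" 
          unfolding gball_def using dvd_mult_left dvd_mult_right by auto
        then show "y \<in> a \<inter> b" using f g by blast
      qed
      moreover have "comax (f * g) x" by (intro comax_mult_left f g)
      ultimately show "x \<noteq> 0 \<and> (\<exists>f. f \<noteq> 0 \<and> comax f x \<and> gball x f \<subseteq> a \<inter> b)"
        using f g by (metis no_zero_divisors)
    qed
  next
    case (UN K)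
    then show ?case by (meson Union_iff Sup_upper order_trans)
  next
    case (Basis s)
    then obtain a I where s: "s = (+) a ` I \<inter> (- {0})" and a: "a \<noteq> 0" and I: "ring_ideal I" "I \<noteq> {0}"
      "ideal_generated (insert a I) = UNIV" by auto
    have I0: "0 \<in> I" and Iadd: "\<And>x y. x \<in> I \<Longrightarrow> y \<in> I \<Longrightarrow> x + y \<in> I" and Imul: "\<And>c x. x \<in> I \<Longrightarrow> c * x \<in> I"
      using I(1) by (auto simp: ring_ideal_iff)
    show ?case
    proof
      fix x assume x: "x \<in> s"
      then obtain i where i: "i \<in> I" "x = a + i" "x \<noteq> 0" using s by auto
      have "1 \<in> ideal_generated (insert a I)" using I by simp
      then obtain r j where rj: "1 = r * a + j" "j \<in> I"
        unfolding ideal_generated_insert[OF I(1)] by auto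
      define f where "f = j - r * i"
      have fI: "f \<in> I" unfolding f_def using rj i Iadd[of j "(-r) * i"] Imul[of i "-r"] by simp
      have f1: "1 = r * x + f" unfolding f_def i(2) rj(1) by (simp add: algebra_simps)
      have "\<exists>f\<in>I. f \<noteq> 0 \<and> comax f x"
      proof (cases "f = 0")
        case False
        then show ?thesis using fI f1 comaxI[of 1 f r x] by (auto simp: add.commute)
      next
        \<comment> \<open>Here \<open>x\<close> is a unit, so any nonzero element of
          \<open>I\<close> is comaximal to it.\<close>
        case True
        then have r: "0 * f + r * x = 1" for f using f1 by simp
        obtain g where "g \<in> I" "g \<noteq> 0" using I I0 by blast
        then show ?thesis using comaxI[OF r] by blast
      qed
      then obtain f where f: "f \<in> I" "f \<noteq> 0" "comax f x" by blast
      have "gball x f \<subseteq> s"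
      proof
        fix y assume "y \<in> gball x f"
        then obtain k where k: "y \<noteq> 0" "y - x = f * k" unfolding gball_def by auto
        have "y = a + (i + k * f)" using k(2) i(2) by (simp add: algebra_simps)
        moreover have "i + k * f \<in> I" using Iadd Imul i f by blast
        ultimately show "y \<in> s" using k s by blast
      qed
      then show "x \<noteq> 0 \<and> (\<exists>f. f \<noteq> 0 \<and> comax f x \<and> gball x f \<subseteq> s)" using f i by blast
    qed
  qed
next
  assume R: "?R U"
  have "openin golomb_topology (gball x f)" if "x \<noteq> 0" "f \<noteq> 0" "comax f x" for x f :: 'a
  proof -
    define I where "I = range ((*) f)"
    have I: "ring_ideal I" unfolding ring_ideal_iff
    proof (intro conjI ballI allI)
      show "0 \<in> I" unfolding I_def by (rule image_eqI[of _ _ 0]) simp_all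
    next
      fix u v assume "u \<in> I" "v \<in> I"
      then obtain k l where "u = f * k" "v = f * l" unfolding I_def by blast
      then have "u + v = f * (k + l)" by (simp add: distrib_left)
      then show "u + v \<in> I" unfolding I_def by blast
    next
      fix c u assume "u \<in> I"
      then obtain k where "u = f * k" unfolding I_def by blast
      then have "c * u = f * (c * k)" by (simp add: mult.left_commute)
      then show "c * u \<in> I" unfolding I_def by blast
    qed
    have "y \<in> {r * x + i | r i. i \<in> I}" for y
    proof -
      obtain r s where "r * f + s * x = 1" using \<open>comax f x\<close> by (auto simp: comax_def)
      then have "y * (r * f + s * x) = y" by simp
      then have "y = (y * s) * x + f * (y * r)" by (simp add: algebra_simps)
      then show ?thesis unfolding I_def by blast
    qed
    then have "ideal_generated (insert x I) = UNIV" unfolding ideal_generated_insert[OF I] by blast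
    moreover have "I \<noteq> {0}" using that unfolding I_def by (metis insertI1 mult.right_neutral rangeI singletonD)
    moreover have "gball x f = (+) x ` I \<inter> (- {0})"
      unfolding gball_def I_def image_image by (auto simp: dvd_def image_iff algebra_simps)
    ultimately show ?thesis unfolding golomb_topology_def using that I
      by (intro topology_generated_by_Basis) blast
  qed
  then have "\<exists>T. openin golomb_topology T \<and> x \<in> T \<and> T \<subseteq> U" if "x \<in> U" for x
    using R that gball_self by metis
  then show "openin golomb_topology U" by (subst openin_subopen) blast
qed

lemma golomb_openE:
  assumes "openin golomb_topology U" "x \<in> U"
  obtains f where "f \<noteq> 0" "comax f x" "gball x f \<subseteq> U" "x \<noteq> 0"
  using assms unfolding openin_golomb_iff by meson

lemma openin_gball:
  fixes x :: "'a::idom"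
  assumes "f \<noteq> 0" "comax f x"
  shows "openin golomb_topology (gball x f)"
  unfolding openin_golomb_iff
proof
  fix y assume y: "y \<in> gball x f"
  then have "comax f y" using assms comax_cong unfolding gball_def by blast
  moreover have "gball y f \<subseteq> gball x f"
  proof
    fix z assume z: "z \<in> gball y f"
    then have "f dvd (z - y) + (y - x)" using y unfolding gball_def by (intro dvd_add) auto
    then show "z \<in> gball x f" using z unfolding gball_def by simp
  qed
  ultimately show "y \<noteq> 0 \<and> (\<exists>g. g \<noteq> 0 \<and> comax g y \<and> gball y g \<subseteq> gball x f)"
    using assms y unfolding gball_def by blast
qed

lemma in_golomb_closure_iff:
  "w \<in> golomb_topology closure_of S \<longleftrightarrow>
     w \<noteq> 0 \<and> (\<forall>h. h \<noteq> 0 \<longrightarrow> comax h w \<longrightarrow> gball w h \<inter> S \<noteq> {})"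
proof
  assume L: "w \<in> golomb_topology closure_of S"
  then have "w \<noteq> 0" by (simp add: in_closure_of topspace_golomb_topology)
  moreover have "gball w h \<inter> S \<noteq> {}" if "h \<noteq> 0" "comax h w" for h
    using L openin_gball[OF that] gball_self[OF \<open>w \<noteq> 0\<close>] unfolding in_closure_of by blast
  ultimately show "w \<noteq> 0 \<and> (\<forall>h. h \<noteq> 0 \<longrightarrow> comax h w \<longrightarrow> gball w h \<inter> S \<noteq> {})" by blast
next
  assume R: "w \<noteq> 0 \<and> (\<forall>h. h \<noteq> 0 \<longrightarrow> comax h w \<longrightarrow> gball w h \<inter> S \<noteq> {})"
  show "w \<in> golomb_topology closure_of S" unfolding in_closure_of topspace_golomb_topology
  proof (intro conjI allI impI)
    show "w \<in> - {0}" using R by simp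
    fix T assume T: "w \<in> T \<and> openin golomb_topology T"
    then obtain f where f: "f \<noteq> 0" "comax f w" "gball w f \<subseteq> T" by (meson golomb_openE)
    then have "gball w f \<inter> S \<noteq> {}" using R by blast
    then show "\<exists>y. y \<in> S \<and> y \<in> T" using f by blast
  qed
qed

text \<open>If comaximality of \<open>h\<close> with \<open>w\<close> forces comaximality with
  \<open>A\<close>, the remainder theorem meets the condition modulo \<open>A\<close> independently
  of the one modulo \<open>h * B\<close>, so only \<open>B\<close> has to be reconciled with
  \<open>h\<close>. In \<open>K[X]\<close> the hypothesis on \<open>A\<close> says that every
  irreducible divisor of \<open>A\<close> divides \<open>w\<close>.\<close>

lemma in_golomb_closureI:
  fixes w :: "'a::idom"
  assumes "w \<noteq> 0" "A \<noteq> 0" "B \<noteq> 0" "comax A B"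
    and A: "\<And>h. h \<noteq> 0 \<Longrightarrow> comax h w \<Longrightarrow> comax h A"
    and B: "\<And>h. h \<noteq> 0 \<Longrightarrow> comax h w \<Longrightarrow> \<exists>v. h dvd v - w \<and> B dvd v - x"
    and S: "gball x (A * B) \<subseteq> S"
  shows "w \<in> golomb_topology closure_of S"
  unfolding in_golomb_closure_iff
proof (intro conjI allI impI assms)
  fix h assume h: "h \<noteq> 0" "comax h w"
  obtain u where u: "h dvd u - w" "B dvd u - x" using B h by blast
  have "comax A (h * B)" using assms h by (intro comax_mult) (auto intro: comax_sym)
  then obtain v where v: "A dvd v - x" "h * B dvd v - u" "v \<noteq> 0"
    using assms h comax_CRT[of A "h * B" x u 0] by (metis no_zero_divisors)
  have vu: "h dvd v - u" "B dvd v - u" using v(2) dvd_mult_left dvd_mult_right by blast+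
  have "h dvd v - w" using dvd_add[OF vu(1) u(1)] by simp
  moreover have B: "B dvd v - x" using dvd_add[OF vu(2) u(2)] by simp
  moreover have "A * B dvd v - x"
  proof -
    obtain r s where rs: "r * A + s * B = 1" using assms by (auto simp: comax_def)
    have AB: "A * B dvd (v - x) * A" "A * B dvd (v - x) * B"
      using v(1) B by (simp_all add: mult_dvd_mono mult.commute[of A B])
    have "A * B dvd r * ((v - x) * A) + s * ((v - x) * B)"
      by (rule dvd_add[OF dvd_mult[OF AB(1)] dvd_mult[OF AB(2)]])
    also have "\<dots> = (v - x) * (r * A + s * B)" by (simp add: algebra_simps)
    finally show ?thesis using rs by simp
  qed
  ultimately have "v \<in> gball w h \<inter> gball x (A * B)" using v unfolding gball_def by blast
  then show "gball w h \<inter> S \<noteq> {}" using S by blast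
qed

section \<open>Topological recovery of the prime ideals\<close>

text \<open>For \<open>K[X]\<close> this relation is inclusion of the sets of irreducible divisors.\<close>

definition closure_le :: "'a topology \<Rightarrow> 'a \<Rightarrow> 'a \<Rightarrow> bool" where
  "closure_le T x y \<longleftrightarrow>
     (\<forall>U V. openin T U \<and> y \<in> U \<and> openin T V \<and> V \<noteq> {} \<longrightarrow>
        (\<exists>U' V'. openin T U' \<and> x \<in> U' \<and> openin T V' \<and> V' \<noteq> {} \<and>
           T closure_of U' \<inter> T closure_of V' \<subseteq> T closure_of U \<inter> T closure_of V))"

text \<open>The up-sets of the minimal elements above the bottom class (the units).\<close>

definition prime_sets :: "'a topology \<Rightarrow> 'a set set" where
  "prime_sets T = {{y \<in> topspace T. closure_le T x y} | x.
     x \<in> topspace T \<and> (\<exists>y\<in>topspace T. \<not> closure_le T x y) \<and>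
     (\<forall>y\<in>topspace T. closure_le T y x \<longrightarrow>
        closure_le T x y \<or> (\<forall>z\<in>topspace T. closure_le T y z))}"

lemma golomb_closure_gballE:
  assumes "w \<in> golomb_topology closure_of U" "U \<subseteq> gball x f" "h \<noteq> 0" "comax h w"
  obtains v where "v \<noteq> 0" "h dvd v - w" "f dvd v - x"
  using assms unfolding in_golomb_closure_iff gball_def by blast

lemma dvd_diff_via_common_neighbour:
  fixes d :: "'a::comm_ring_1"
  assumes "d dvd v - w" "d dvd v - y" "d dvd v' - w" "d dvd v' - z"
  shows "d dvd y - z"
proof -
  have "d dvd ((v - w) - (v - y)) - ((v' - w) - (v' - z))"
    by (rule dvd_diff[OF dvd_diff[OF assms(1,2)] dvd_diff[OF assms(3,4)]])
  then show ?thesis by simp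
qed

text \<open>If \<open>p\<close> divides \<open>x\<close> but not \<open>y\<close>, test with the
  balls modulo \<open>p\<close> about \<open>y\<close> and about some \<open>z\<close> prime to
  \<open>p\<close> in another class. A common closure point prime to \<open>p\<close> would be
  congruent to both centres, so all common closure points are multiples of \<open>p\<close>. But
  admissible moduli at \<open>x\<close> are prime to \<open>p\<close>, so any neighbourhood of
  \<open>x\<close> and any nonempty open set have a common closure point prime to
  \<open>p\<close>.\<close>

lemma closure_le_imp_irreducible_dvd:
  fixes x y :: "'k::field poly"
  assumes inf: "infinite (UNIV :: 'k set)" and le: "closure_le golomb_topology x y"
    and nz: "x \<noteq> 0" "y \<noteq> 0" and p: "irreducible p" "p dvd x"
  shows "p dvd y"
proof (rule ccontr)
  assume py: "\<not> p dvd y"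
  have p0: "p \<noteq> 0" "\<not> p dvd 1" using p(1) by (auto simp: irreducible_def)
  obtain z where z: "z \<noteq> 0" "\<not> p dvd z" "\<not> p dvd y - z"
  proof -
    \<comment> \<open>The constants 1 and \<open>c\<close> lie in different nonzero classes modulo
      \<open>p\<close>, so at least one of them avoids the class of \<open>y\<close>.\<close>
    have "\<exists>c::'k. c \<notin> {0, 1}" using inf by (metis ex_new_if_finite finite.emptyI finite.insertI)
    then obtain c :: 'k where c: "c \<noteq> 0" "c \<noteq> 1" by auto
    have "\<not> p dvd [:c:]" using c p0 by (metis dvd_trans is_unit_triv)
    moreover have "\<not> (p dvd y - 1 \<and> p dvd y - [:c:])"
    proof
      assume "p dvd y - 1 \<and> p dvd y - [:c:]"
      then have "p dvd (y - 1) - (y - [:c:])" by (elim conjE) (rule dvd_diff)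
      then have "p dvd [:c - 1:]" by (simp add: one_pCons)
      then show False using c p0 by (metis dvd_trans is_unit_triv eq_iff_diff_eq_0)
    qed
    ultimately show ?thesis using that[of 1] that[of "[:c:]"] p0 c by auto
  qed
  have "comax p y" "comax p z" using irreducible_comax_iff p py z by blast+
  then have "openin golomb_topology (gball y p)" "openin golomb_topology (gball z p)"
    "y \<in> gball y p" "gball z p \<noteq> {}"
    using openin_gball p0 gball_self nz z by blast+
  then obtain U V where U: "openin golomb_topology U" "x \<in> U" and V: "openin golomb_topology V" "V \<noteq> {}"
    and cl: "golomb_topology closure_of U \<inter> golomb_topology closure_of V \<subseteq>
       golomb_topology closure_of gball y p \<inter> golomb_topology closure_of gball z p"
    using le unfolding closure_le_def by meson
  have div: "p dvd w" if w: "w \<in> golomb_topology closure_of U" "w \<in> golomb_topology closure_of V" for w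
  proof (rule ccontr)
    assume "\<not> p dvd w"
    then have pw: "comax p w" using irreducible_comax_iff p by blast
    have "w \<in> golomb_topology closure_of gball y p" "w \<in> golomb_topology closure_of gball z p"
      using w cl by blast+
    then obtain v v' where "p dvd v - w" "p dvd v - y" "p dvd v' - w" "p dvd v' - z"
      using golomb_closure_gballE[OF _ subset_refl \<open>p \<noteq> 0\<close> pw] by metis
    then show False using dvd_diff_via_common_neighbour z by blast
  qed
  obtain f where f: "f \<noteq> 0" "comax f x" "gball x f \<subseteq> U" using U by (rule golomb_openE)
  obtain t where t: "t \<in> V" using V by blast
  obtain g where g: "g \<noteq> 0" "comax g t" "gball t g \<subseteq> V" "t \<noteq> 0" using V(1) t by (rule golomb_openE)
  obtain z' where z': "z' \<noteq> 0" "z' \<in> gball t g" "\<not> p dvd z'"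
  proof (cases "p dvd t")
    case False then show ?thesis using that g gball_self by blast
  next
    case True
    have "comax p g" using comax_dvd[OF g(2) dvd_refl True] comax_sym by blast
    then obtain w where w: "p dvd w - 1" "g dvd w - t" "w \<noteq> 0" using comax_CRT[of p g 1 t 0] p0 g by blast
    have "\<not> p dvd w"
    proof
      assume "p dvd w"
      then have "p dvd w - (w - 1)" using w(1) by (rule dvd_diff)
      then show False using p0 by simp
    qed
    then show ?thesis using that w unfolding gball_def by blast
  qed
  have gz': "comax g z'" using z' comax_cong g unfolding gball_def by blast
  have sub: "gball z' (p * g) \<subseteq> V"
  proof
    fix u assume u: "u \<in> gball z' (p * g)"
    then have "g dvd u - z'" "g dvd z' - t" using z' dvd_mult_right unfolding gball_def by auto
    then have "g dvd (u - z') + (z' - t)" by (rule dvd_add)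
    then show "u \<in> V" using u g unfolding gball_def by auto
  qed
  \<comment> \<open>The extra factor \<open>p\<close> makes the \<open>p\<close>-part
    \<open>B\<close> divisible by \<open>p\<close>, so a point congruent to \<open>z'\<close> modulo
    \<open>B\<close> stays prime to \<open>p\<close>.\<close>
  have pg: "p * g \<noteq> 0" using p0 g by simp
  then obtain A B N where AB: "p * g = A * B" "comax A p" "B dvd p ^ N" by (rule comax_split)
  have AB0: "A \<noteq> 0" "B \<noteq> 0" using AB pg by auto
  have "p dvd A * B" using AB(1) by (metis dvd_triv_left)
  moreover have "\<not> p dvd A" using AB(2) p0 comax_self_dvd comax_sym by blast
  ultimately have pB: "p dvd B" using irreducible_dvd_multD p by blast
  have fp: "comax f p" using comax_dvd[OF f(2) dvd_refl p(2)] .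
  have fB: "comax f B" "comax A B"
    using comax_dvd[OF comax_power[OF fp] dvd_refl AB(3)] comax_dvd[OF comax_power[OF AB(2)] dvd_refl AB(3)] .
  then have "comax (f * A) B" by (rule comax_mult_left)
  \<comment> \<open>Divisibility of \<open>w\<close> by \<open>f\<close> and \<open>A\<close>
    neutralises these moduli in both closures; only the congruence modulo \<open>B\<close> has to be
    arranged.\<close>
  then obtain w where w: "f * A dvd w - 0" "B dvd w - z'" "w \<noteq> 0"
    using comax_CRT[of "f * A" B 0 z' 0] f(1) AB0 by (metis no_zero_divisors)
  have fA: "f dvd w" "A dvd w" using w(1) dvd_mult_left dvd_mult_right by auto
  have "\<not> p dvd w"
  proof
    assume "p dvd w"
    then have "p dvd w - (w - z')" using dvd_trans[OF pB w(2)] by (rule dvd_diff)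
    then show False using z' by simp
  qed
  moreover have "w \<in> golomb_topology closure_of U"
    by (rule in_golomb_closureI[of w f 1 x])
       (use w f fA comax_dvd[OF _ dvd_refl fA(1)] in \<open>auto intro: exI[of _ w]\<close>)
  moreover have "w \<in> golomb_topology closure_of V"
    by (rule in_golomb_closureI[of w A B z'])
       (use w AB0 AB sub fA fB comax_dvd[OF _ dvd_refl fA(2)] in \<open>auto intro: exI[of _ w]\<close>)
  ultimately show False using div by blast
qed

text \<open>Inclusion of supports makes the modulus \<open>f\<close> at \<open>y\<close> admissible
  at \<open>x\<close>. With \<open>A\<close> the part of the modulus of \<open>V\<close> prime to
  \<open>x\<close>, a power of \<open>C = f * A\<close> is imposed both at \<open>x\<close> and at a
  new centre \<open>z'\<close>. As \<open>z' \<noteq> x\<close>, a common closure point must be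
  divisible by all irreducible divisors of \<open>C\<close>, so \<open>f\<close> and
  \<open>A\<close> no longer obstruct; the condition modulo \<open>B\<close> is inherited from the
  new ball because \<open>z'\<close> is congruent to \<open>z\<close> modulo
  \<open>B\<close>.\<close>

lemma irreducible_dvd_imp_closure_le:
  fixes x y :: "'k::field poly"
  assumes nz: "x \<noteq> 0" "y \<noteq> 0" and supp: "\<And>p. irreducible p \<Longrightarrow> p dvd x \<Longrightarrow> p dvd y"
  shows "closure_le golomb_topology x y"
  unfolding closure_le_def
proof (intro allI impI, elim conjE)
  fix U V :: "'k poly set"
  assume U: "openin golomb_topology U" "y \<in> U" and V: "openin golomb_topology V" "V \<noteq> {}"
  obtain f where f: "f \<noteq> 0" "comax f y" "gball y f \<subseteq> U" using U by (rule golomb_openE)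
  obtain z where "z \<in> V" using V by blast
  with V(1) obtain g where g: "g \<noteq> 0" "comax g z" "gball z g \<subseteq> V" "z \<noteq> 0" by (rule golomb_openE)
  have fx: "comax f x"
  proof (rule ccontr)
    assume "\<not> comax f x"
    then obtain p where p: "irreducible p" "p dvd f" "p dvd x" using not_comax_irreducibleE f(1) by blast
    then show False using comax_self_dvd[OF comax_dvd[OF f(2) p(2) dvd_refl] supp[OF p(1,3)]]
      by (auto simp: irreducible_def)
  qed
  obtain A B N where AB: "g = A * B" "comax A x" "B dvd x ^ N" using g(1) by (rule comax_split)
  have AB0: "A \<noteq> 0" "B \<noteq> 0" using AB g by auto
  define C where "C = f * A"
  have C0: "C \<noteq> 0" and Cx: "comax C x" using f AB0 fx AB unfolding C_def by (auto intro: comax_mult_left)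
  have CB: "comax C B" using comax_dvd[OF comax_power[OF Cx] dvd_refl AB(3)] .
  then obtain z' where z': "C dvd z' - 1" "B dvd z' - z" "z' \<noteq> x" 
    using comax_CRT[of C B 1 z x] C0 AB0 by blast
  have "B dvd z - z'" using z'(2) by (simp add: dvd_diff_commute)
  have "comax B z" using comax_dvd[OF g(2)] AB(1) by simp
  then have Bz': "comax B z'" using comax_cong z'(2) by blast
  have Cz': "comax C z'" by (rule comax_cong[OF comax_one(2) z'(1)])
  \<comment> \<open>No irreducible \<open>q\<close> satisfies \<open>q ^ n dvd x - z'\<close>, which forces every irreducible divisor of \<open>C\<close> to
    divide each common closure point of \<open>U'\<close> and \<open>V'\<close>.\<close>
  define n where "n = Suc (degree (x - z'))"
  define U' where "U' = gball x (C ^ n)"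
  define V' where "V' = gball z' (C ^ n * B)"
  have U': "openin golomb_topology U'" "x \<in> U'"
    unfolding U'_def using nz C0 Cx by (auto intro!: openin_gball gball_self comax_power_left)
  have V': "openin golomb_topology V'"
    unfolding V'_def using C0 AB0 Cz' Bz' by (auto intro!: openin_gball comax_power_left comax_mult_left)
  \<comment> \<open>The one value that the remainder theorem avoids was spent on \<open>x\<close>,
    so \<open>z'\<close> may be 0.\<close>
  have "V' \<noteq> {}"
  proof (cases "z' = 0")
    case True
    then have "C ^ n * B \<in> V'" using C0 AB0 unfolding V'_def gball_def by simp
    then show ?thesis by blast
  next
    case False then show ?thesis unfolding V'_def using gball_self by blast
  qed
  have "w \<in> golomb_topology closure_of U \<and> w \<in> golomb_topology closure_of V"
    if w: "w \<in> golomb_topology closure_of U'" "w \<in> golomb_topology closure_of V'" for w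
  proof -
    have w0: "w \<noteq> 0" using w unfolding in_golomb_closure_iff by blast
    have hC: "comax h C" if h: "h \<noteq> 0" "comax h w" for h
    proof (rule ccontr)
      assume "\<not> comax h C"
      then obtain q where q: "irreducible q" "q dvd h" "q dvd C" using not_comax_irreducibleE h by blast
      have q0: "q ^ n \<noteq> 0" using q by (auto simp: irreducible_def)
      have qw: "comax (q ^ n) w" using comax_dvd[OF h(2) q(2) dvd_refl] comax_power_left by blast
      have qC: "q ^ n dvd C ^ n" using q by (simp add: dvd_power_same)
      obtain v where v: "q ^ n dvd v - w" "C ^ n dvd v - x"
        using golomb_closure_gballE[OF w(1) _ q0 qw] unfolding U'_def by blast
      obtain v' where v': "q ^ n dvd v' - w" "C ^ n * B dvd v' - z'"
        using golomb_closure_gballE[OF w(2) _ q0 qw] unfolding V'_def by blast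
      have "q ^ n dvd v - x" "q ^ n dvd v' - z'"
        using v v' qC dvd_trans dvd_mult_left by blast+
      then have "q ^ n dvd x - z'" using v v' dvd_diff_via_common_neighbour by blast
      moreover have "\<not> q ^ n dvd x - z'"
        by (rule power_not_dvd) (use q z' in \<open>auto simp: irreducible_def n_def\<close>)
      ultimately show False by blast
    qed
    have "w \<in> golomb_topology closure_of U"
      by (rule in_golomb_closureI[of w f 1 y])
         (use w0 f comax_dvd[OF hC dvd_refl, of _ f] in \<open>auto intro: exI[of _ w] simp: C_def\<close>)
    moreover have "w \<in> golomb_topology closure_of V"
    proof (rule in_golomb_closureI[of w A B z])
      show "comax A B" using comax_dvd[OF CB] by (simp add: C_def)
      fix h assume h: "h \<noteq> 0" "comax h w"
      show "comax h A" using comax_dvd[OF hC[OF h] dvd_refl] by (simp add: C_def)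
      obtain v where v: "h dvd v - w" "C ^ n * B dvd v - z'"
        using golomb_closure_gballE[OF w(2) _ h] unfolding V'_def by blast
      have "B dvd (v - z') + (z' - z)" by (rule dvd_add[OF dvd_mult_right[OF v(2)] z'(2)])
      then show "\<exists>v. h dvd v - w \<and> B dvd v - z" using v(1) by auto
    qed (use w0 AB0 AB g in auto)
    ultimately show ?thesis by blast
  qed
  then show "\<exists>U' V'. openin golomb_topology U' \<and> x \<in> U' \<and> openin golomb_topology V' \<and> V' \<noteq> {} \<and>
      golomb_topology closure_of U' \<inter> golomb_topology closure_of V'
        \<subseteq> golomb_topology closure_of U \<inter> golomb_topology closure_of V"
    using U' V' \<open>V' \<noteq> {}\<close> by blast
qed

lemma closure_le_golomb_iff:
  fixes x y :: "'k::field poly"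
  assumes "infinite (UNIV :: 'k set)" "x \<noteq> 0" "y \<noteq> 0"
  shows "closure_le golomb_topology x y \<longleftrightarrow> (\<forall>p. irreducible p \<longrightarrow> p dvd x \<longrightarrow> p dvd y)"
  using closure_le_imp_irreducible_dvd irreducible_dvd_imp_closure_le assms by metis

lemma irreducible_dvd_irreducibleD:
  fixes p q :: "'k::field poly"
  assumes "irreducible p" "irreducible q" "p dvd q"
  shows "q dvd p"
  using assms irreducible_comax_iff comax_sym by metis

lemma closure_le_golomb_irreducible_iff:
  fixes p y :: "'k::field poly"
  assumes inf: "infinite (UNIV :: 'k set)" and p: "irreducible p" and y: "y \<noteq> 0"
  shows "closure_le golomb_topology p y \<longleftrightarrow> p dvd y"
proof -
  have "p \<noteq> 0" using p by auto
  then have "closure_le golomb_topology p y \<longleftrightarrow> (\<forall>q. irreducible q \<longrightarrow> q dvd p \<longrightarrow> q dvd y)"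
    by (rule closure_le_golomb_iff[OF inf _ y])
  also have "\<dots> \<longleftrightarrow> p dvd y"
    using p irreducible_dvd_irreducibleD[OF _ p] by (meson dvd_refl dvd_trans)
  finally show ?thesis .
qed

text \<open>Minimal nonempty supports are singletons: an irreducible divisor \<open>p\<close> of
  \<open>x\<close> lies below \<open>x\<close>, and minimality forces \<open>x\<close> below
  \<open>p\<close>.\<close>

lemma prime_sets_golomb:
  assumes inf: "infinite (UNIV :: 'k::field set)"
  shows "prime_sets golomb_topology = {{y. y \<noteq> 0 \<and> p dvd y} | p :: 'k poly. irreducible p}" (is "?L = ?R")
proof (intro set_eqI iffI)
  fix S :: "'k poly set" assume "S \<in> ?R"
  then obtain p where p: "irreducible p" and S: "S = {y. y \<noteq> 0 \<and> p dvd y}" by blast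
  have p0: "p \<noteq> 0" using p by auto
  have le: "closure_le golomb_topology p y \<longleftrightarrow> p dvd y" if "y \<noteq> 0" for y
    using closure_le_golomb_irreducible_iff[OF inf _ that] p by blast
  have "\<not> p dvd 1" using p by (auto simp: irreducible_def)
  then have "\<not> closure_le golomb_topology p 1" using le by simp
  moreover have "closure_le golomb_topology p y \<or> (\<forall>z. z \<noteq> 0 \<longrightarrow> closure_le golomb_topology y z)"
    if y: "y \<noteq> 0" "closure_le golomb_topology y p" for y
  proof (cases "\<exists>q. irreducible q \<and> q dvd y")
    case True
    then obtain q where q: "irreducible q" "q dvd y" by blast
    then have "q dvd p" using closure_le_golomb_iff[OF inf y(1) p0] y by blast
    then have "p dvd y" using irreducible_dvd_irreducibleD[OF q(1) p] dvd_trans[OF _ q(2)] by blast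
    then show ?thesis using le y by blast
  next
    case False
    then show ?thesis using closure_le_golomb_iff[OF inf y(1)] by blast
  qed
  moreover have "S = {y \<in> topspace golomb_topology. closure_le golomb_topology p y}"
    using S le by (auto simp: topspace_golomb_topology)
  ultimately show "S \<in> ?L" unfolding prime_sets_def topspace_golomb_topology
    using p0 by (intro CollectI exI[of _ p]) auto
next
  fix S :: "'k poly set" assume "S \<in> ?L"
  then obtain x where S: "S = {y \<in> - {0}. closure_le golomb_topology x y}" and x: "x \<noteq> 0"
    and nb: "\<exists>y\<in>-{0}. \<not> closure_le golomb_topology x y"
    and min: "\<forall>y\<in>-{0}. closure_le golomb_topology y x \<longrightarrow>
        closure_le golomb_topology x y \<or> (\<forall>z\<in>-{0}. closure_le golomb_topology y z)"
    unfolding prime_sets_def topspace_golomb_topology by blast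
  obtain p where p: "irreducible p" "p dvd x"
    using nb closure_le_golomb_iff[OF inf x] by blast
  have p0: "p \<noteq> 0" using p by auto
  have le: "closure_le golomb_topology p y \<longleftrightarrow> p dvd y" if "y \<noteq> 0" for y
    using closure_le_golomb_irreducible_iff[OF inf _ that] p by blast
  have "\<not> p dvd 1" using p by (auto simp: irreducible_def)
  then have "\<not> closure_le golomb_topology p 1" using le by simp
  then have xp: "closure_le golomb_topology x p" using min p0 x le p by (metis ComplI one_neq_zero singletonD)
  have "closure_le golomb_topology x y \<longleftrightarrow> p dvd y" if "y \<noteq> 0" for y
    using xp p le that closure_le_golomb_iff[OF inf] x p0 by (metis dvd_trans)
  then show "S \<in> ?R" using p S by (intro CollectI exI[of _ p]) auto
qed

section \<open>Adically open submonoids\<close>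

definition clopen_off :: "'a topology \<Rightarrow> 'a set \<Rightarrow> 'a set \<Rightarrow> bool" where
  "clopen_off T P M \<longleftrightarrow> M \<subseteq> topspace T - P \<and> openin T M \<and> openin T (topspace T - P - M)"

text \<open>In \<open>K[X]\<close> the complement of the union of \<open>D\<close> consists of the
  nonzero elements without irreducible divisor in the chosen family, hence a multiplicative monoid
  described topologically. Demanding a least clopen superset keeps only those families for which one
  exists.\<close>

definition generated_clopens :: "'a topology \<Rightarrow> 'a set \<Rightarrow> 'a set set" where
  "generated_clopens T P = {M. clopen_off T P M \<and>
     (\<exists>D. D \<subseteq> prime_sets T \<and> topspace T - \<Union>D \<subseteq> M \<and>
        (\<forall>C. clopen_off T P C \<and> topspace T - \<Union>D \<subseteq> C \<longrightarrow> M \<subseteq> C))}"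

text \<open>One exponent serves for the whole of \<open>M\<close>, which is thus a union of classes
  modulo \<open>p ^ Suc e\<close>; the successor keeps this modulus divisible by
  \<open>p\<close>.\<close>

definition open_submonoids :: "'a::comm_ring_1 \<Rightarrow> 'a set set" where
  "open_submonoids p = {M. (\<forall>x\<in>M. \<not> p dvd x) \<and> (\<forall>u. u dvd 1 \<longrightarrow> u \<in> M) \<and>
     (\<forall>x\<in>M. \<forall>y\<in>M. x * y \<in> M) \<and>
     (\<exists>e. \<forall>x\<in>M. \<forall>y. p ^ Suc e dvd y - x \<longrightarrow> y \<in> M)}"

lemma open_submonoidsI:
  assumes "\<And>u. u dvd 1 \<Longrightarrow> u \<in> M" "\<And>x y. x \<in> M \<Longrightarrow> y \<in> M \<Longrightarrow> x * y \<in> M"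
    "\<And>x. x \<in> M \<Longrightarrow> \<not> p dvd x" "\<And>x y. x \<in> M \<Longrightarrow> p ^ Suc e dvd y - x \<Longrightarrow> y \<in> M"
  shows "M \<in> open_submonoids p"
  unfolding open_submonoids_def mem_Collect_eq
  by (intro conjI ballI allI impI exI[of _ e]) (fact assms)+

lemma open_submonoidsE:
  assumes "M \<in> open_submonoids p"
  obtains e where "\<And>u. u dvd 1 \<Longrightarrow> u \<in> M" "\<And>x y. x \<in> M \<Longrightarrow> y \<in> M \<Longrightarrow> x * y \<in> M"
    "\<And>x. x \<in> M \<Longrightarrow> \<not> p dvd x" "\<And>x y. x \<in> M \<Longrightarrow> p ^ Suc e dvd y - x \<Longrightarrow> y \<in> M"
proof -
  have "\<exists>e. \<forall>x\<in>M. \<forall>y. p ^ Suc e dvd y - x \<longrightarrow> y \<in> M" using assms unfolding open_submonoids_def by simp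
  then obtain e where "\<forall>x\<in>M. \<forall>y. p ^ Suc e dvd y - x \<longrightarrow> y \<in> M" by (elim exE)
  moreover have "\<forall>u. u dvd 1 \<longrightarrow> u \<in> M" "\<forall>x\<in>M. \<forall>y\<in>M. x * y \<in> M" "\<forall>x\<in>M. \<not> p dvd x"
    using assms unfolding open_submonoids_def by simp_all
  ultimately show thesis by (metis that)
qed

section \<open>Clopen sets off a prime are the \<open>p\<close>-adically clopen ones\<close>

lemma comax_irreducible_power:
  fixes p x :: "'a::euclidean_ring"
  assumes "irreducible p" "\<not> p dvd x"
  shows "comax (p ^ k) x"
  using assms irreducible_comax_iff comax_power_left by blast

lemma not_dvd_cong: "p dvd y - x \<Longrightarrow> p dvd y \<longleftrightarrow> p dvd (x::'a::comm_ring_1)"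
  by (metis add_diff_cancel_right' diff_add_cancel dvd_add_right_iff)

lemma dvd_diff_trans: "d dvd y - x \<Longrightarrow> d dvd z - y \<Longrightarrow> d dvd z - (x::'a::comm_ring_1)"
  using dvd_add[of d "z - y" "y - x"] by simp

lemma dvd_diff_mult: "d dvd a - b \<Longrightarrow> d dvd a' - b' \<Longrightarrow> d dvd a * a' - b * (b'::'a::comm_ring_1)"
  using dvd_add[OF dvd_mult2[of d "a - b" a'] dvd_mult[of d "a' - b'" b]] by (simp add: algebra_simps)

text \<open>Suppose some \<open>y\<close> in \<open>M'\<close> is \<open>p\<close>-adically close to
  \<open>x\<close>. A point \<open>w\<close> divisible by the prime-to-\<open>p\<close> parts of the
  moduli at \<open>x\<close> and at \<open>y\<close>, and congruent to \<open>y\<close> modulo a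
  high power of \<open>p\<close>, lies in the closures of both sets. Being prime to
  \<open>p\<close>, it also lies in one of these disjoint open sets.\<close>

lemma disjoint_open_imp_adic_open:
  fixes p :: "'k::field poly"
  assumes p: "irreducible p" and op: "openin golomb_topology M" "openin golomb_topology M'"
    and dj: "M \<inter> M' = {}" and un: "M \<union> M' = {y. \<not> p dvd y}" and x: "x \<in> M"
  shows "\<exists>e. \<forall>y. p ^ Suc e dvd y - x \<longrightarrow> y \<in> M"
proof -
  have p0: "p \<noteq> 0" using p by auto
  obtain f where f: "f \<noteq> 0" "comax f x" "gball x f \<subseteq> M" using op(1) x by (rule golomb_openE)
  obtain A B N where AB: "f = A * B" "comax A p" "B dvd p ^ N" using f(1) by (rule comax_split)
  have AB0: "A \<noteq> 0" "B \<noteq> 0" using AB f by auto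
  \<comment> \<open>The exponent \<open>N\<close> already covers \<open>B\<close>; the successor
    ensures that \<open>y\<close> is prime to \<open>p\<close> even when
    \<open>N = 0\<close>.\<close>
  have "y \<in> M" if y: "p ^ Suc N dvd y - x" for y
  proof (rule ccontr)
    assume "y \<notin> M"
    have "\<not> p dvd x" using un x by blast
    moreover have "p dvd y - x" using y by (metis dvd_trans dvd_triv_left power_Suc)
    ultimately have py: "\<not> p dvd y" using not_dvd_cong by blast
    then have yM: "y \<in> M'" using un \<open>y \<notin> M\<close> by blast
    obtain g where g: "g \<noteq> 0" "comax g y" "gball y g \<subseteq> M'" using op(2) yM by (rule golomb_openE)
    obtain A' B' N' where AB': "g = A' * B'" "comax A' p" "B' dvd p ^ N'" using g(1) by (rule comax_split)
    have AB'0: "A' \<noteq> 0" "B' \<noteq> 0" using AB' g by auto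
    define L where "L = max (Suc N) N'"
    have "comax (A * A') (p ^ L)" using AB AB' by (intro comax_power comax_mult_left)
    moreover have "A * A' \<noteq> 0" "p ^ L \<noteq> 0" using AB0 AB'0 p0 by simp_all
    ultimately obtain w where w: "A * A' dvd w - 0" "p ^ L dvd w - y" "w \<noteq> 0"
      by (rule comax_CRT)
    have Aw: "A dvd w" "A' dvd w" using w(1) dvd_mult_left dvd_mult_right by auto
    have "p ^ Suc N dvd w - y" using w(2) power_le_dvd unfolding L_def by (metis max.cobounded1)
    then have wx: "p ^ Suc N dvd w - x" using y dvd_diff_trans by blast
    then have "p dvd w - x" by (metis dvd_trans dvd_triv_left power_Suc)
    then have "\<not> p dvd w" using \<open>\<not> p dvd x\<close> not_dvd_cong by blast
    then have wU: "w \<in> M \<union> M'" using un by blast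
    have "B dvd w - x" using dvd_trans[OF AB(3) power_le_dvd[OF wx]] by simp
    then have "w \<in> golomb_topology closure_of M"
      by (intro in_golomb_closureI[of w A B x])
         (use w AB0 AB f comax_dvd[OF _ dvd_refl Aw(1)] comax_dvd[OF comax_power[OF AB(2)] dvd_refl AB(3)] in
          \<open>auto intro: exI[of _ w]\<close>)
    moreover have "p ^ N' dvd w - y" using w(2) power_le_dvd unfolding L_def by (metis max.cobounded2)
    then have "B' dvd w - y" using AB'(3) dvd_trans by blast
    then have "w \<in> golomb_topology closure_of M'"
      by (intro in_golomb_closureI[of w A' B' y])
         (use w AB'0 AB' g comax_dvd[OF _ dvd_refl Aw(2)] comax_dvd[OF comax_power[OF AB'(2)] dvd_refl AB'(3)] in
          \<open>auto intro: exI[of _ w]\<close>)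
    ultimately show False using wU op dj unfolding in_closure_of by blast
  qed
  then show ?thesis by blast
qed

text \<open>One direction applies the preceding separation argument to \<open>M\<close> and to its
  complement; for the other, powers of \<open>p\<close> are admissible moduli at all points prime to
  \<open>p\<close>.\<close>

lemma clopen_off_golomb_iff:
  fixes p :: "'k::field poly"
  assumes p: "irreducible p"
  shows "clopen_off golomb_topology {y. y \<noteq> 0 \<and> p dvd y} M \<longleftrightarrow>
     (\<forall>x\<in>M. \<not> p dvd x) \<and>
     (\<forall>x. \<not> p dvd x \<longrightarrow> (\<exists>e. \<forall>y. p ^ Suc e dvd y - x \<longrightarrow> (y \<in> M \<longleftrightarrow> x \<in> M)))" (is "?L \<longleftrightarrow> ?R")
proof -
  have D: "topspace golomb_topology - {y. y \<noteq> 0 \<and> p dvd y} = {y. \<not> p dvd y}"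
    unfolding topspace_golomb_topology by auto
  show ?thesis
  proof
    assume ?L
    then have op: "openin golomb_topology M" "openin golomb_topology ({y. \<not> p dvd y} - M)"
      and sub: "M \<subseteq> {y. \<not> p dvd y}" unfolding clopen_off_def D by auto
    have "\<exists>e. \<forall>y. p ^ Suc e dvd y - x \<longrightarrow> (y \<in> M \<longleftrightarrow> x \<in> M)" if x: "\<not> p dvd x" for x
    proof (cases "x \<in> M")
      case True
      then have "\<exists>e. \<forall>y. p ^ Suc e dvd y - x \<longrightarrow> y \<in> M"
        by (intro disjoint_open_imp_adic_open[OF p op]) (use sub in auto)
      then show ?thesis using True by blast
    next
      case False
      then have "\<exists>e. \<forall>y. p ^ Suc e dvd y - x \<longrightarrow> y \<in> {y. \<not> p dvd y} - M"
        by (intro disjoint_open_imp_adic_open[OF p op(2,1)]) (use sub x in auto)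
      then show ?thesis using False by blast
    qed
    then show ?R using sub by blast
  next
    assume R: ?R
    have p0: "p \<noteq> 0" using p by auto
    have opn: "openin golomb_topology S"
      if S: "\<And>x. x \<in> S \<Longrightarrow> \<not> p dvd x \<and> (\<exists>e. \<forall>y. p ^ Suc e dvd y - x \<longrightarrow> y \<in> S)" for S
      unfolding openin_golomb_iff
    proof
      fix x assume "x \<in> S"
      with S obtain e where e: "\<not> p dvd x" "\<forall>y. p ^ Suc e dvd y - x \<longrightarrow> y \<in> S" by blast
      have "comax (p ^ Suc e) x" using e p irreducible_comax_iff comax_power_left by blast
      moreover have "gball x (p ^ Suc e) \<subseteq> S" using e unfolding gball_def by blast
      ultimately show "x \<noteq> 0 \<and> (\<exists>f. f \<noteq> 0 \<and> comax f x \<and> gball x f \<subseteq> S)"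
        using e p0 by (metis dvd_0_right power_not_zero)
    qed
    have "openin golomb_topology M"
    proof (rule opn)
      fix x assume x: "x \<in> M"
      then have "\<not> p dvd x" using R by blast
      then obtain e where "\<forall>y. p ^ Suc e dvd y - x \<longrightarrow> (y \<in> M \<longleftrightarrow> x \<in> M)" using R by blast
      then show "\<not> p dvd x \<and> (\<exists>e. \<forall>y. p ^ Suc e dvd y - x \<longrightarrow> y \<in> M)"
        using x \<open>\<not> p dvd x\<close> by blast
    qed
    moreover have "openin golomb_topology ({y. \<not> p dvd y} - M)"
    proof (rule opn)
      fix x assume x: "x \<in> {y. \<not> p dvd y} - M"
      then obtain e where e: "\<forall>y. p ^ Suc e dvd y - x \<longrightarrow> (y \<in> M \<longleftrightarrow> x \<in> M)" using R by blast
      have "\<not> p dvd y" if "p ^ Suc e dvd y - x" for y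
      proof -
        have "p dvd y - x" using that by (metis dvd_trans dvd_triv_left power_Suc)
        then show ?thesis using x not_dvd_cong by blast
      qed
      then show "\<not> p dvd x \<and> (\<exists>e. \<forall>y. p ^ Suc e dvd y - x \<longrightarrow> y \<in> {y. \<not> p dvd y} - M)"
        using e x by blast
    qed
    ultimately show ?L unfolding clopen_off_def D using R by blast
  qed
qed

section \<open>Generated clopen sets and open submonoids\<close>

lemma mem_of_irreducible_factors:
  fixes M :: "'k::field poly set"
  assumes "\<And>u. u dvd 1 \<Longrightarrow> u \<in> M" "\<And>x y. x \<in> M \<Longrightarrow> y \<in> M \<Longrightarrow> x * y \<in> M"
    and "y \<noteq> 0" "\<And>q. irreducible q \<Longrightarrow> q dvd y \<Longrightarrow> q \<in> M"
  shows "y \<in> M"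
  using assms(3,4)
proof (induction "degree y" arbitrary: y rule: less_induct)
  case less
  show ?case
  proof (cases "y dvd 1")
    case True then show ?thesis using assms by blast
  next
    case False
    then obtain q where q: "irreducible q" "q dvd y" using ex_irreducible_dvd less.prems(1) by blast
    obtain z where z: "y = q * z" using q by auto
    have z0: "z \<noteq> 0" using z less.prems(1) by auto
    have "degree q > 0" using q(1) by (auto simp: irreducible_def poly_unit_degree[of q])
    then have "degree z < degree y" using z z0 less.prems(1) by (auto simp: degree_mult_eq)
    then have "z \<in> M" using less.hyps less.prems(2) z0 z by (metis dvd_mult)
    then show ?thesis using assms(2) less.prems(2) q z by blast
  qed
qed

text \<open>Take for \<open>D\<close> the primes whose generators lie outside \<open>M\<close>.
  Elements avoiding \<open>D\<close> are products of members of \<open>M\<close>. Dirichlet density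
  approximates each \<open>x \<in> M\<close> by an irreducible \<open>q\<close> modulo a high power
  of \<open>p\<close>; openness puts \<open>q\<close> into \<open>M\<close>, so \<open>q\<close>
  avoids \<open>D\<close>, and every competing clopen set contains \<open>q\<close> and therefore
  \<open>x\<close>.\<close>

lemma open_submonoids_generated:
  fixes p :: "'k::field poly"
  assumes inf: "infinite (UNIV :: 'k set)" and dir: "dirichlet_field TYPE('k)"
    and p: "irreducible p" and M: "M \<in> open_submonoids p"
  shows "M \<in> generated_clopens golomb_topology {y. y \<noteq> 0 \<and> p dvd y}"
proof -
  define P where "P = {y. y \<noteq> 0 \<and> p dvd y}"
  obtain e where unit: "\<And>u. u dvd 1 \<Longrightarrow> u \<in> M" and mult: "\<And>x y. x \<in> M \<Longrightarrow> y \<in> M \<Longrightarrow> x * y \<in> M"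
    and sub: "\<And>x. x \<in> M \<Longrightarrow> \<not> p dvd x" and e: "\<And>x y. x \<in> M \<Longrightarrow> p ^ Suc e dvd y - x \<Longrightarrow> y \<in> M"
    using M by (rule open_submonoidsE) (rule that)
  have p0: "p \<noteq> 0" using p by auto
  have M_iff: "y \<in> M \<longleftrightarrow> x \<in> M" if "p ^ Suc e dvd y - x" for x y
    using e that by (metis dvd_diff_commute)
  have clM: "clopen_off golomb_topology P M"
    unfolding P_def clopen_off_golomb_iff[OF p] using M_iff sub by blast
  define D where "D = {{y. y \<noteq> 0 \<and> q dvd y} | q. irreducible q \<and> q \<notin> M}"
  define E where "E = topspace golomb_topology - \<Union>D"
  have E_iff: "y \<in> E \<longleftrightarrow> y \<noteq> 0 \<and> (\<forall>q. irreducible q \<longrightarrow> q dvd y \<longrightarrow> q \<in> M)" for y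
    unfolding E_def D_def topspace_golomb_topology by auto
  have "D \<subseteq> prime_sets golomb_topology" unfolding D_def prime_sets_golomb[OF inf] by blast
  moreover have "E \<subseteq> M"
  proof
    fix y assume "y \<in> E"
    then have "y \<noteq> 0" "\<And>q. irreducible q \<Longrightarrow> q dvd y \<Longrightarrow> q \<in> M" unfolding E_iff by simp_all
    with unit mult show "y \<in> M" by (rule mem_of_irreducible_factors)
  qed
  moreover have "M \<subseteq> C" if C: "clopen_off golomb_topology P C" "E \<subseteq> C" for C
  proof
    fix x assume x: "x \<in> M"
    have px: "\<not> p dvd x" using sub x .
    obtain d where d: "\<And>y. p ^ Suc d dvd y - x \<Longrightarrow> y \<in> C \<longleftrightarrow> x \<in> C"
      using C(1) px unfolding P_def clopen_off_golomb_iff[OF p] by blast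
    define k where "k = Suc (max d e)"
    have pk: "p ^ k \<noteq> 0" "comax (p ^ k) x" using p0 comax_irreducible_power[OF p px] by simp_all
    have "x \<in> golomb_topology closure_of {q. irreducible q}"
      using dir px unfolding dirichlet_field_def topspace_golomb_topology by auto
    then obtain q where q: "irreducible q" "p ^ k dvd q - x"
      using pk unfolding in_golomb_closure_iff gball_def by blast
    have "p ^ Suc e dvd q - x" "p ^ Suc d dvd q - x"
      by (rule power_le_dvd[OF q(2)]; simp add: k_def)+
    then have qM: "q \<in> M" and qC: "q \<in> C \<longleftrightarrow> x \<in> C" by - (rule e[OF x], assumption, rule d)
    \<comment> \<open>The irreducible divisors of \<open>q\<close> are its associates, which stay in
      \<open>M\<close> because \<open>M\<close> contains the units.\<close>
    have "q \<in> E" unfolding E_iff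
    proof (intro conjI allI impI)
      show "q \<noteq> 0" using q by auto
      fix r assume r: "irreducible r" "r dvd q"
      then obtain u where u: "q = r * u" by auto
      have "u dvd 1" using q(1) u r(1) by (auto simp: irreducible_def)
      then obtain v where "1 = u * v" by auto
      then have "r = q * v" "v dvd 1" using u by (auto simp: mult.assoc intro: dvdI[of _ _ u] simp: mult.commute)
      then show "r \<in> M" using mult qM unit by blast
    qed
    then show "x \<in> C" using C qC by blast
  qed
  ultimately show ?thesis using clM unfolding generated_clopens_def P_def E_def by blast
qed

text \<open>The elements \<open>E\<close> avoiding a family of primes form a monoid. They are
  \<open>p\<close>-adically dense in \<open>M\<close>, since a ball about a point of
  \<open>M\<close> that misses \<open>E\<close> could be removed from the least set; so products
  pass from \<open>E\<close> to \<open>M\<close>. The local exponents are made uniform by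
  translating the one at 1 with approximate inverses.\<close>

lemma generated_clopens_open_submonoid:
  fixes p :: "'k::field poly"
  assumes inf: "infinite (UNIV :: 'k set)"
    and p: "irreducible p" and M: "M \<in> generated_clopens golomb_topology {y. y \<noteq> 0 \<and> p dvd y}"
  shows "M \<in> open_submonoids p"
proof -
  define P where "P = {y. y \<noteq> 0 \<and> p dvd y}"
  have clM: "clopen_off golomb_topology P M" using M unfolding generated_clopens_def P_def by simp
  have "\<exists>D. D \<subseteq> prime_sets golomb_topology \<and> topspace golomb_topology - \<Union>D \<subseteq> M \<and>
        (\<forall>C. clopen_off golomb_topology P C \<and> topspace golomb_topology - \<Union>D \<subseteq> C \<longrightarrow> M \<subseteq> C)"
    using M unfolding generated_clopens_def P_def by simp
  then obtain D where D: "D \<subseteq> prime_sets golomb_topology"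
    and EM: "topspace golomb_topology - \<Union>D \<subseteq> M"
    and least: "\<And>C. clopen_off golomb_topology P C \<Longrightarrow> topspace golomb_topology - \<Union>D \<subseteq> C \<Longrightarrow> M \<subseteq> C"
    by (elim exE conjE) simp
  define E where "E = topspace golomb_topology - \<Union>D"
  have Q: "\<exists>q. irreducible q \<and> S = {y. y \<noteq> 0 \<and> q dvd y}" if "S \<in> D" for S
    using D that unfolding prime_sets_golomb[OF inf] by blast
  have E1: "u \<in> E" if "u dvd 1" for u
  proof -
    have "u \<noteq> 0" using that by auto
    moreover have "u \<notin> S" if "S \<in> D" for S
      using Q[OF that] \<open>u dvd 1\<close> dvd_trans by (auto simp: irreducible_def)
    ultimately show ?thesis unfolding E_def topspace_golomb_topology by blast
  qed
  have Emult: "x * y \<in> E" if xy: "x \<in> E" "y \<in> E" for x y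
  proof -
    have nz: "x \<noteq> 0" "y \<noteq> 0" using xy unfolding E_def topspace_golomb_topology by auto
    have "x * y \<notin> S" if S: "S \<in> D" for S
    proof
      assume a: "x * y \<in> S"
      obtain q where q: "irreducible q" "S = {y. y \<noteq> 0 \<and> q dvd y}" using Q[OF S] by blast
      then have "q dvd x \<or> q dvd y" using a irreducible_dvd_multD by blast
      then have "x \<in> S \<or> y \<in> S" using q nz by blast
      then show False using xy S unfolding E_def by blast
    qed
    then show ?thesis using nz unfolding E_def topspace_golomb_topology by auto
  qed
  have sub: "\<not> p dvd x" if "x \<in> M" for x
    using clM that unfolding P_def clopen_off_golomb_iff[OF p] by blast
  have cl: "\<exists>e. \<forall>y. p ^ Suc e dvd y - x \<longrightarrow> (y \<in> M \<longleftrightarrow> x \<in> M)" if "\<not> p dvd x" for x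
    using clM that unfolding P_def clopen_off_golomb_iff[OF p] by blast
  have approx: "\<exists>s\<in>E. p ^ Suc k dvd s - x" if x: "x \<in> M" for x k
  proof (rule ccontr)
    assume no: "\<not> (\<exists>s\<in>E. p ^ Suc k dvd s - x)"
    define C where "C = {y \<in> M. \<not> p ^ Suc k dvd y - x}"
    have "clopen_off golomb_topology P C" unfolding P_def clopen_off_golomb_iff[OF p]
    proof (intro conjI ballI allI impI)
      fix y assume "y \<in> C" then show "\<not> p dvd y" using sub C_def by blast
    next
      fix y assume "\<not> p dvd y"
      then obtain e where e: "\<And>z. p ^ Suc e dvd z - y \<Longrightarrow> z \<in> M \<longleftrightarrow> y \<in> M" using cl by blast
      have "z \<in> C \<longleftrightarrow> y \<in> C" if z: "p ^ Suc (max e k) dvd z - y" for z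
      proof -
        have "p ^ Suc e dvd z - y" "p ^ Suc k dvd z - y"
          using z by (auto intro: power_le_dvd simp del: power_Suc)
        moreover have "p ^ Suc k dvd z - x \<longleftrightarrow> p ^ Suc k dvd y - x"
          using \<open>p ^ Suc k dvd z - y\<close> dvd_diff_trans by (metis dvd_diff_commute)
        ultimately show ?thesis using e unfolding C_def by blast
      qed
      then show "\<exists>e. \<forall>z. p ^ Suc e dvd z - y \<longrightarrow> (z \<in> C \<longleftrightarrow> y \<in> C)" by blast
    qed
    moreover have "E \<subseteq> C" using no EM unfolding C_def E_def by blast
    ultimately have "x \<in> C" using least x unfolding E_def by blast
    then show False unfolding C_def by simp
  qed
  have mult: "x * y \<in> M" if xy: "x \<in> M" "y \<in> M" for x y
  proof -
    have "\<not> p dvd x * y" using xy sub irreducible_dvd_multD[OF p] by blast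
    then obtain e where e: "\<And>z. p ^ Suc e dvd z - x * y \<Longrightarrow> z \<in> M \<longleftrightarrow> x * y \<in> M" using cl by blast
    obtain s where s: "s \<in> E" "p ^ Suc e dvd s - x" using approx xy by blast
    obtain t where t: "t \<in> E" "p ^ Suc e dvd t - y" using approx xy by blast
    have "s * t \<in> M" using Emult[OF s(1) t(1)] EM E_def by auto
    then show ?thesis by (rule iffD1[OF e[OF dvd_diff_mult[OF s(2) t(2)]]])
  qed
  have unit: "u \<in> M" if "u dvd 1" for u using E1[OF that] EM unfolding E_def by blast
  have "\<not> p dvd 1" using p by (auto simp: irreducible_def)
  from cl[OF this] obtain e where "\<forall>y. p ^ Suc e dvd y - 1 \<longrightarrow> (y \<in> M \<longleftrightarrow> 1 \<in> M)" by (elim exE)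
  then have e: "\<And>y. p ^ Suc e dvd y - 1 \<Longrightarrow> y \<in> M" using unit[OF dvd_refl] by simp
  have "y \<in> M" if x: "x \<in> M" and y: "p ^ Suc e dvd y - x" for x y
  proof -
    have px: "\<not> p dvd x" using x sub by blast
    have "p dvd y - x" using y by (metis dvd_trans dvd_triv_left power_Suc)
    then have "\<not> p dvd y" using px not_dvd_cong by blast
    then obtain e' where e': "\<And>z. p ^ Suc e' dvd z - y \<Longrightarrow> z \<in> M \<longleftrightarrow> y \<in> M" using cl by blast
    \<comment> \<open>The inverse \<open>s\<close> of \<open>x\<close> must be accurate for
      \<open>e\<close>, so that \<open>s * y\<close> lies in \<open>M\<close>, and for
      \<open>e'\<close>, where \<open>x * (s * y)\<close> is compared with \<open>y\<close>.\<close>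
    define k where "k = Suc (max e e')"
    have "comax (p ^ k) x" using p px by (rule comax_irreducible_power)
    then obtain r s where rs: "r * p ^ k + s * x = 1" unfolding comax_def by blast
    have "s * x - 1 = p ^ k * (- r)" using rs by (simp add: algebra_simps)
    then have sx: "p ^ k dvd s * x - 1" by (metis dvd_triv_left)
    have le: "p ^ Suc e dvd p ^ k" "p ^ Suc e' dvd p ^ k" unfolding k_def by (intro le_imp_power_dvd; simp)+
    have "p ^ Suc e dvd s * y - s * x" using y by (metis dvd_mult right_diff_distrib)
    then have "p ^ Suc e dvd s * y - 1" by (rule dvd_diff_trans[OF dvd_trans[OF le(1) sx]])
    then have "x * (s * y) \<in> M" using mult[OF x e] by simp
    moreover have "p ^ k dvd (s * x - 1) * y" using sx by (rule dvd_mult2)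
    then have "p ^ Suc e' dvd (s * x - 1) * y" by (rule dvd_trans[OF le(2)])
    moreover have "(s * x - 1) * y = x * (s * y) - y" by (simp add: algebra_simps)
    ultimately have "x * (s * y) \<in> M \<and> p ^ Suc e' dvd x * (s * y) - y" by simp
    then show ?thesis using e' by metis
  qed
  then show ?thesis using unit mult sub by (intro open_submonoidsI)
qed

lemma generated_clopens_golomb:
  fixes p :: "'k::field poly"
  assumes "infinite (UNIV :: 'k set)" "dirichlet_field TYPE('k)" "irreducible p"
  shows "generated_clopens golomb_topology {y. y \<noteq> 0 \<and> p dvd y} = open_submonoids p"
  using assms open_submonoids_generated generated_clopens_open_submonoid by blast

section \<open>Intervals of saturated submonoids\<close>

text \<open>The substitute for a subgroup where inverses are missing: for an open submonoid, closure
  under cancellation means that its classes modulo a power of \<open>p\<close> form a group.\<close>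

definition saturated_submonoid :: "'a::comm_monoid_mult set \<Rightarrow> bool" where
  "saturated_submonoid L \<longleftrightarrow> 1 \<in> L \<and> (\<forall>x\<in>L. \<forall>y\<in>L. x * y \<in> L) \<and> (\<forall>x\<in>L. \<forall>y. x * y \<in> L \<longrightarrow> y \<in> L)"

text \<open>The inverse powers of \<open>a\<close> are adjoined; if some power of \<open>a\<close> lies in \<open>M\<close>, this is the saturated
  submonoid generated by \<open>M\<close> and \<open>a\<close>.\<close>

definition adjoin :: "'a::comm_monoid_mult set \<Rightarrow> 'a \<Rightarrow> 'a set" where
  "adjoin M a = {y. \<exists>i. y * a ^ i \<in> M}"

definition between :: "'a set set \<Rightarrow> 'a set \<Rightarrow> 'a set \<Rightarrow> 'a set set" where
  "between F M N = {L \<in> F. M \<subset> L \<and> L \<subset> N}"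

text \<open>Phrased through inclusions alone, so that it is preserved by isomorphisms of families.
  Incomparability of the intermediate members expresses height at most two. Infinite intervals have
  \<open>card\<close> 0, so a count \<open>m \<ge> 2\<close> implies finiteness.\<close>

definition antichain_interval :: "'a set set \<Rightarrow> nat \<Rightarrow> bool" where
  "antichain_interval F m \<longleftrightarrow> (\<exists>M\<in>F. \<exists>N\<in>F. card (between F M N) = m \<and>
     (\<forall>A\<in>between F M N. \<forall>B\<in>between F M N. A \<subseteq> B \<longrightarrow> A = B))"

section \<open>Powers and cancellation in saturated submonoids\<close>

lemma saturated_one: "saturated_submonoid L \<Longrightarrow> 1 \<in> L"
  and saturated_mult: "saturated_submonoid L \<Longrightarrow> x \<in> L \<Longrightarrow> y \<in> L \<Longrightarrow> x * y \<in> L"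
  and saturated_cancel: "saturated_submonoid L \<Longrightarrow> x \<in> L \<Longrightarrow> x * y \<in> L \<Longrightarrow> y \<in> L"
  unfolding saturated_submonoid_def by blast+

lemma saturated_cancel_right: "saturated_submonoid L \<Longrightarrow> y \<in> L \<Longrightarrow> x * y \<in> L \<Longrightarrow> x \<in> L"
  by (metis saturated_cancel mult.commute)

lemma saturated_power: "saturated_submonoid L \<Longrightarrow> x \<in> L \<Longrightarrow> x ^ n \<in> L"
  by (induction n) (auto intro: saturated_one saturated_mult)

lemma saturated_power_dvd:
  assumes "saturated_submonoid L" "x ^ m \<in> L" "m dvd n" shows "x ^ n \<in> L"
proof -
  obtain k where "n = m * k" using assms(3) by auto
  then show ?thesis using saturated_power[OF assms(1,2), of k] by (simp add: power_mult)
qed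

text \<open>Bezout over the naturals, \<open>m * u = n * v + gcd m n\<close>, followed by cancelling
  \<open>x ^ (n * v)\<close>.\<close>

lemma saturated_power_gcd:
  assumes L: "saturated_submonoid L" and "x ^ m \<in> L" "x ^ n \<in> L"
  shows "x ^ gcd m n \<in> L"
proof (cases "m = 0")
  case True then show ?thesis using assms by simp
next
  case False
  then obtain u v where uv: "m * u = n * v + gcd m n" using bezout_nat by blast
  have "x ^ (n * v) \<in> L" "x ^ (m * u) \<in> L" using saturated_power_dvd[OF L] assms by auto
  then show ?thesis using saturated_cancel[OF L] uv by (metis power_add)
qed

lemma adjoin_superset: "M \<subseteq> adjoin M a"
proof
  fix x assume "x \<in> M"
  then have "x * a ^ 0 \<in> M" by simp
  then show "x \<in> adjoin M a" unfolding adjoin_def by blast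
qed

lemma mem_adjoin:
  assumes "a ^ n \<in> M" "n > 0" shows "a \<in> adjoin M a"
proof -
  have "a * a ^ (n - 1) \<in> M" using assms by (metis Suc_diff_1 power_Suc)
  then show ?thesis unfolding adjoin_def by blast
qed

lemma adjoin_subset:
  assumes L: "saturated_submonoid L" "M \<subseteq> L" "a \<in> L" shows "adjoin M a \<subseteq> L"
proof
  fix y assume "y \<in> adjoin M a"
  then obtain i where "y * a ^ i \<in> L" using L unfolding adjoin_def by blast
  then show "y \<in> L" using saturated_cancel_right[OF L(1) saturated_power[OF L(1,3)]] by blast
qed

text \<open>The quotient of \<open>N\<close> (below) by \<open>M\<close> is \<open>(\<int>/q)\<^sup>2\<close>; its lines are spanned by the elements \<open>gen t\<close>.\<close>

locale rank_two_extension =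
  fixes M :: "'a::comm_monoid_mult set" and a b :: 'a and q :: nat
  assumes q: "prime q" and M: "saturated_submonoid M"
    and aq: "a ^ q \<in> M" and bq: "b ^ q \<in> M" and aM: "a \<notin> M" and bM: "b \<notin> adjoin M a"
begin

definition N where "N = adjoin (adjoin M a) b"

text \<open>The points of the projective line over Z/q: \<open>t < q\<close> is a slope and
  \<open>t = q\<close> encodes the remaining direction, so the index set \<open>{..q}\<close> has
  \<open>q + 1\<close> elements.\<close>

definition gen where "gen t = (if t = q then b else a * b ^ t)"

lemma q1: "q > 1" using q prime_gt_1_nat by blast

lemma N_iff: "y \<in> N \<longleftrightarrow> (\<exists>i j. y * (a ^ i * b ^ j) \<in> M)"
  unfolding N_def adjoin_def by (auto simp: mult_ac)

lemma power_mem_imp_mem: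
  assumes L: "saturated_submonoid L" and "x ^ q \<in> L" "x ^ j \<in> L" "\<not> q dvd j"
  shows "x \<in> L"
proof -
  have "gcd q j = 1" using q assms(4) by (simp add: prime_imp_coprime coprime_imp_gcd_eq_1)
  then show ?thesis using saturated_power_gcd[OF L assms(2,3)] by simp
qed

text \<open>Independence of \<open>a\<close> and \<open>b\<close> over \<open>M\<close>: if
  \<open>q\<close> does not divide \<open>j\<close>, a power \<open>u\<close> inverting
  \<open>j\<close> modulo \<open>q\<close> turns the monomial into \<open>b\<close> times a power of
  \<open>a\<close>, up to a power of \<open>b ^ q\<close>, contradicting
  \<open>b \<notin> adjoin M a\<close>.\<close>

lemma monomial_mem_iff: "a ^ i * b ^ j \<in> M \<longleftrightarrow> q dvd i \<and> q dvd j"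
proof
  assume h: "a ^ i * b ^ j \<in> M"
  show "q dvd i \<and> q dvd j"
  proof (cases "q dvd j")
    case True
    have "a ^ i \<in> M" using h saturated_cancel_right[OF M saturated_power_dvd[OF M bq True]] by blast
    then show ?thesis using True power_mem_imp_mem[OF M aq] aM by blast
  next
    case False
    obtain u v where uv: "j * u = q * v + gcd j q" 
      using bezout_nat[of j q] False by (metis dvd_0_right)
    have "gcd j q = 1" using q False by (metis gcd.commute prime_imp_coprime coprime_imp_gcd_eq_1)
    then have "(a ^ i * b ^ j) ^ u = (b ^ q) ^ v * (b * a ^ (i * u))"
      by (simp add: power_mult_distrib uv mult_ac power_add flip: power_mult)
    then have "b * a ^ (i * u) \<in> M"
      using saturated_power[OF M h, of u] saturated_cancel[OF M saturated_power[OF M bq]] by metis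
    then show ?thesis using bM unfolding adjoin_def by blast
  qed
next
  assume "q dvd i \<and> q dvd j"
  then show "a ^ i * b ^ j \<in> M" using saturated_mult[OF M] saturated_power_dvd[OF M] aq bq by blast
qed

lemma N_subset:
  assumes L: "saturated_submonoid L" "M \<subseteq> L" "a \<in> L" "b \<in> L"
  shows "N \<subseteq> L"
  unfolding N_def using L by (intro adjoin_subset)

lemma a_mem_N: "a \<in> N" and b_mem_N: "b \<in> N"
proof -
  show "a \<in> N" unfolding N_def using adjoin_superset mem_adjoin[OF aq] q1 by (metis subsetD gr_implies_not0 gr0I)
  show "b \<in> N" unfolding N_def using adjoin_superset bq q1 by (intro mem_adjoin[of _ q]) auto
qed

lemma gen_power_mem: "gen t ^ q \<in> M"
proof (cases "t = q")
  case False
  then have "gen t ^ q = a ^ q * b ^ (t * q)" by (simp add: gen_def power_mult_distrib power_mult)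
  then show ?thesis using monomial_mem_iff by simp
qed (simp add: gen_def bq)

lemma gen_mem_adjoin: "gen t \<in> adjoin M (gen t)"
  using mem_adjoin[OF gen_power_mem] q1 by simp

lemma adjoin_gen_subset: "adjoin M (gen t) \<subseteq> N"
proof
  fix y assume "y \<in> adjoin M (gen t)"
  then obtain k where k: "y * gen t ^ k \<in> M" unfolding adjoin_def by blast
  show "y \<in> N"
  proof (cases "t = q")
    case True
    then have "y * (a ^ 0 * b ^ k) \<in> M" using k by (simp add: gen_def)
    then show ?thesis unfolding N_iff by blast
  next
    case False
    then have "y * (a ^ k * b ^ (t * k)) \<in> M" using k by (simp add: gen_def power_mult_distrib power_mult)
    then show ?thesis unfolding N_iff by blast
  qed
qed

lemma gen_mem_adjoin_gen:
  assumes "s \<le> q" "t \<le> q" "gen s \<in> adjoin M (gen t)"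
  shows "s = t"
proof (rule ccontr)
  assume st: "s \<noteq> t"
  obtain k where k: "gen s * gen t ^ k \<in> M" using assms(3) unfolding adjoin_def by blast
  have nq: "\<not> q dvd 1" using q1 by simp
  consider "s = q" "t < q" | "t = q" "s < q" | "s < q" "t < q" using assms st by linarith
  then show False
  proof cases
    case 1
    then have "a ^ k * b ^ (1 + t * k) \<in> M"
      using k by (simp add: gen_def power_mult_distrib mult_ac flip: power_mult)
    then have "q dvd k" "q dvd 1 + t * k" using monomial_mem_iff by blast+
    then show False using nq by (metis dvd_add_left_iff dvd_mult)
  next
    case 2
    then have "a ^ 1 * b ^ (s + k) \<in> M" using k by (simp add: gen_def power_add mult_ac)
    then show False using nq monomial_mem_iff by blast
  next
    case 3
    then have "a ^ (1 + k) * b ^ (s + t * k) \<in> M"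
      using k by (simp add: gen_def power_mult_distrib power_add mult_ac flip: power_mult)
    then have d: "q dvd 1 + k" "q dvd s + t * k" using monomial_mem_iff by blast+
    have "int q dvd int (1 + k)" "int q dvd int (s + t * k)" using d by (simp_all only: int_dvd_int_iff)
    then have "int q dvd int t * int (1 + k) - int (s + t * k)" by (intro dvd_diff dvd_mult)
    then have "int q dvd int t - int s" by (simp add: algebra_simps)
    moreover have "\<bar>int t - int s\<bar> < int q" "int t - int s \<noteq> 0" using 3 st by auto
    ultimately show False using dvd_imp_le_int[of "int t - int s" "int q"] by simp
  qed
qed

context
  fixes F :: "'a set set"
  assumes sat: "\<And>L. L \<in> F \<Longrightarrow> M \<subseteq> L \<Longrightarrow> L \<subseteq> N \<Longrightarrow> saturated_submonoid L"
    and genF: "\<And>t. adjoin M (gen t) \<in> F"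
begin

lemma adjoin_gen_between: "t \<le> q \<Longrightarrow> adjoin M (gen t) \<in> between F M N"
proof -
  assume t: "t \<le> q"
  have "gen t \<notin> M"
  proof
    assume "gen t \<in> M"
    then have "a ^ 0 * b ^ 1 \<in> M \<or> a ^ 1 * b ^ t \<in> M" unfolding gen_def by (auto split: if_splits)
    then show False unfolding monomial_mem_iff using q1 by simp
  qed
  moreover have "N \<noteq> adjoin M (gen t)"
  proof
    assume eq: "N = adjoin M (gen t)"
    have "gen q \<in> N" "gen 0 \<in> N" using a_mem_N b_mem_N q1 by (simp_all add: gen_def)
    then have "gen q \<in> adjoin M (gen t)" "gen 0 \<in> adjoin M (gen t)" unfolding eq .
    then show False using gen_mem_adjoin_gen[of q t] gen_mem_adjoin_gen[of 0 t] t q1 by simp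
  qed
  ultimately show ?thesis
    unfolding between_def using genF adjoin_gen_subset adjoin_superset[of M "gen t"] gen_mem_adjoin by blast
qed

text \<open>A proper intermediate \<open>L\<close> cannot contain both \<open>a\<close> and
  \<open>b\<close>. Removing from the monomial of an element its component along
  \<open>gen t\<close> leaves a power of one generator outside \<open>L\<close>; its exponent is
  then divisible by \<open>q\<close>, so this power lies in \<open>M\<close>.\<close>

lemma between_eq_adjoin:
  assumes L: "L \<in> between F M N" and t: "t \<le> q" and g: "gen t \<in> L"
  shows "L = adjoin M (gen t)"
proof
  have M_sub: "M \<subseteq> L" and L_sub: "L \<subset> N" and S: "saturated_submonoid L"
    using L sat unfolding between_def by blast+
  show "adjoin M (gen t) \<subseteq> L" using adjoin_subset[OF S M_sub g] .
  have ab: "\<not> (a \<in> L \<and> b \<in> L)" using N_subset[OF S M_sub] L_sub by blast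
  have mono_mem: "a ^ (q * k) \<in> L" "b ^ (q * k) \<in> L" "a ^ (q * k) \<in> M" "b ^ (q * k) \<in> M" for k
    using saturated_power[OF M aq, of k] saturated_power[OF M bq, of k] M_sub by (auto simp: power_mult)
  have aqL: "a ^ q \<in> L" "b ^ q \<in> L" using aq bq M_sub by auto
  show "L \<subseteq> adjoin M (gen t)"
  proof
    fix y assume y: "y \<in> L"
    then obtain i j where ij: "y * (a ^ i * b ^ j) \<in> M" using L_sub N_iff by blast
    then have z: "a ^ i * b ^ j \<in> L" using saturated_cancel[OF S y] M_sub by blast
    show "y \<in> adjoin M (gen t)"
    proof (cases "t = q")
      case True
      then have bL: "b \<in> L" using g by (simp add: gen_def)
      have "a ^ i \<in> L" using saturated_cancel_right[OF S saturated_power[OF S bL] z] .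
      then have "q dvd i" using power_mem_imp_mem[OF S aqL(1)] ab bL by blast
      then have "a ^ i \<in> M" using saturated_power_dvd[OF M aq] by blast
      then have "y * b ^ j \<in> M" using ij saturated_cancel[OF M] by (metis mult.left_commute)
      then show ?thesis unfolding adjoin_def gen_def using True by auto
    next
      case False
      then have c: "gen t = a * b ^ t" by (simp add: gen_def)
      have ci: "gen t ^ i \<in> L" using saturated_power[OF S g] .
      \<comment> \<open>The wanted exponent is \<open>j - t * i\<close>; adding
        \<open>q * (t * i)\<close> keeps it natural without changing it modulo
        \<open>q\<close>.\<close>
      define d where "d = j + (q - 1) * (t * i)"
      have de: "d + t * i = j + q * (t * i)" unfolding d_def using q1 by (cases q) (simp_all add: algebra_simps)
      have e: "gen t ^ i * b ^ d = (a ^ i * b ^ j) * b ^ (q * (t * i))"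
      proof -
        have "gen t ^ i * b ^ d = a ^ i * b ^ (d + t * i)"
          by (simp add: c power_mult_distrib power_add mult_ac flip: power_mult)
        also have "\<dots> = (a ^ i * b ^ j) * b ^ (q * (t * i))" unfolding de by (simp add: power_add mult_ac)
        finally show ?thesis .
      qed
      have "b ^ d \<in> L" using saturated_cancel[OF S ci] saturated_mult[OF S z mono_mem(2)] e by metis
      moreover have "b \<notin> L"
      proof
        assume b: "b \<in> L"
        then have "a \<in> L" using g c saturated_cancel_right[OF S saturated_power[OF S b]] by metis
        then show False using b ab by blast
      qed
      ultimately have "q dvd d" using power_mem_imp_mem[OF S aqL(2)] by blast
      then have bd: "b ^ d \<in> M" using saturated_power_dvd[OF M bq] by blast
      have "(y * (a ^ i * b ^ j)) * b ^ (q * (t * i)) \<in> M" using saturated_mult[OF M ij mono_mem(4)] .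
      then have "(y * gen t ^ i) * b ^ d \<in> M" using e by (metis mult.assoc)
      then have "y * gen t ^ i \<in> M" using saturated_cancel_right[OF M bd] by blast
      then show ?thesis unfolding adjoin_def by blast
    qed
  qed
qed

text \<open>Any element of \<open>L\<close> outside \<open>M\<close> yields a nontrivial vector
  \<open>a ^ i * b ^ j\<close> in \<open>L\<close>. If \<open>q\<close> does not divide
  \<open>i\<close>, rescaling the first coordinate to 1 exhibits the slope
  \<open>j * u mod q\<close>; otherwise \<open>b\<close> lies in \<open>L\<close>.\<close>

lemma between_eq: "between F M N = (\<lambda>t. adjoin M (gen t)) ` {..q}"
proof
  show "(\<lambda>t. adjoin M (gen t)) ` {..q} \<subseteq> between F M N" using adjoin_gen_between by auto
  show "between F M N \<subseteq> (\<lambda>t. adjoin M (gen t)) ` {..q}"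
  proof
    fix L assume L: "L \<in> between F M N"
    then have M_sub: "M \<subset> L" and L_sub: "L \<subset> N" and S: "saturated_submonoid L"
      using sat unfolding between_def by blast+
    obtain y where y: "y \<in> L" "y \<notin> M" using M_sub by blast
    then obtain i j where ij: "y * (a ^ i * b ^ j) \<in> M" using L_sub N_iff by blast
    then have z: "a ^ i * b ^ j \<in> L" using saturated_cancel[OF S y(1)] M_sub by blast
    have aL: "a ^ q \<in> L" and bL: "b ^ q \<in> L" using aq bq M_sub by auto
    have "\<exists>t\<le>q. gen t \<in> L"
    proof (cases "q dvd i")
      case True
      have "\<not> q dvd j"
      proof
        assume "q dvd j"
        then have "a ^ i * b ^ j \<in> M" using True monomial_mem_iff by blast
        then show False using saturated_cancel_right[OF M _ ij] y by blast
      qed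
      have "b ^ j \<in> L" using saturated_cancel[OF S saturated_power_dvd[OF S aL True] z] .
      then have "b \<in> L" using power_mem_imp_mem[OF S bL] \<open>\<not> q dvd j\<close> by blast
      then have "gen q \<in> L" by (simp add: gen_def)
      then show ?thesis by blast
    next
      case False
      obtain u v where uv: "i * u = q * v + gcd i q" 
        using bezout_nat[of i q] False by (metis dvd_0_right)
      have "gcd i q = 1" using q False by (metis gcd.commute prime_imp_coprime coprime_imp_gcd_eq_1)
      then have uv: "i * u = q * v + 1" using uv by simp
      have "(a ^ i * b ^ j) ^ u = a ^ (i * u) * b ^ (j * u)" by (simp add: power_mult_distrib power_mult)
      also have "\<dots> = a ^ (q * v) * (a * b ^ (j * u))" unfolding uv by (simp add: power_add mult_ac)
      finally have "a ^ (q * v) * (a * b ^ (j * u)) \<in> L" using saturated_power[OF S z] by metis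
      then have "a * b ^ (j * u) \<in> L" using saturated_cancel[OF S saturated_power_dvd[OF S aL dvd_triv_left]] by blast
      moreover have "b ^ (j * u) = b ^ (j * u mod q) * b ^ (q * (j * u div q))"
        by (simp flip: power_add)
      ultimately have "(a * b ^ (j * u mod q)) * b ^ (q * (j * u div q)) \<in> L" by (simp add: mult.assoc)
      then have "a * b ^ (j * u mod q) \<in> L" 
        using saturated_cancel_right[OF S saturated_power_dvd[OF S bL dvd_triv_left]] by blast
      moreover have "j * u mod q < q" using q1 by simp
      ultimately show ?thesis by (intro exI[of _ "j * u mod q"]) (simp add: gen_def)
    qed
    then obtain t where t: "t \<le> q" "gen t \<in> L" by blast
    then have "L = adjoin M (gen t)" by (rule between_eq_adjoin[OF L])
    then show "L \<in> (\<lambda>t. adjoin M (gen t)) ` {..q}" using t by blast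
  qed
qed

lemma card_between: "card (between F M N) = Suc q"
proof -
  have "inj_on (\<lambda>t. adjoin M (gen t)) {..q}"
    by (rule inj_onI) (metis gen_mem_adjoin gen_mem_adjoin_gen atMost_iff)
  then show ?thesis unfolding between_eq by (simp add: card_image)
qed

lemma antichain_between:
  assumes "A \<in> between F M N" "B \<in> between F M N" "A \<subseteq> B"
  shows "A = B"
proof -
  obtain t where t: "t \<le> q" "A = adjoin M (gen t)" using assms(1) unfolding between_eq by auto
  then show ?thesis using between_eq_adjoin[OF assms(2) t(1)] gen_mem_adjoin assms(3) by blast
qed

end

end

text \<open>Incomparability makes every intermediate \<open>L\<close> minimal over \<open>M\<close>,
  hence generated by any of its elements outside \<open>M\<close>. Elements \<open>a\<close> and
  \<open>b\<close> from two such members span an extension of rank two, which exhausts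
  \<open>N\<close> because it lies properly above the first member.\<close>

lemma antichain_interval_prime:
  assumes q: "prime q"
    and sat: "\<And>L. L \<in> F \<Longrightarrow> saturated_submonoid L"
    and tors: "\<And>L M x. M \<in> F \<Longrightarrow> L \<in> F \<Longrightarrow> x \<in> L \<Longrightarrow> \<exists>k. x ^ (q ^ k) \<in> M"
    and adj: "\<And>M a. M \<in> F \<Longrightarrow> adjoin M a \<in> F"
    and m: "antichain_interval F m" "m \<ge> 2"
  shows "m = Suc q"
proof -
  obtain M N where MF: "M \<in> F" and NF: "N \<in> F" and card: "card (between F M N) = m"
    and anti: "\<And>A B. A \<in> between F M N \<Longrightarrow> B \<in> between F M N \<Longrightarrow> A \<subseteq> B \<Longrightarrow> A = B"
    using m unfolding antichain_interval_def by blast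
  obtain L1 L2 where L: "L1 \<in> between F M N" "L2 \<in> between F M N" "L1 \<noteq> L2"
    using card m(2) by (metis card_le_Suc0_iff_eq card.infinite not_less_eq_eq numeral_2_eq_2 zero_le)
  have q1: "q > 1" using q prime_gt_1_nat by blast
  have satM: "saturated_submonoid M" using sat MF .
  have single: "L = adjoin M x \<and> x ^ q \<in> M" if LB: "L \<in> between F M N" and x: "x \<in> L" "x \<notin> M" for L x
  proof -
    have LF: "L \<in> F" and M_sub: "M \<subseteq> L" and L_sub: "L \<subset> N" using LB unfolding between_def by auto
    obtain k where k: "x ^ (q ^ k) \<in> M" using tors[OF MF LF x(1)] by blast
    have eq: "adjoin M z = L" if z: "z \<in> L" "z \<notin> M" for z
    proof -
      obtain k where "z ^ (q ^ k) \<in> M" using tors[OF MF LF z(1)] by blast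
      then have "z \<in> adjoin M z" using mem_adjoin q1 by (metis zero_less_power gr_zeroI not_less_zero)
      moreover have "adjoin M z \<subseteq> L" using adjoin_subset[OF sat[OF LF] M_sub z(1)] .
      ultimately have "adjoin M z \<in> between F M N"
        unfolding between_def using adj[OF MF] adjoin_superset[of M z] z L_sub by blast
      then show ?thesis using anti LB \<open>adjoin M z \<subseteq> L\<close> by blast
    qed
    \<comment> \<open>Otherwise \<open>x ^ q\<close> would generate \<open>L\<close>, so
      \<open>M\<close> would contain \<open>x ^ (1 + q * j)\<close> for some \<open>j\<close>; this
      exponent is coprime to \<open>q ^ k\<close>, which would put \<open>x\<close> into
      \<open>M\<close>.\<close>
    have "x ^ q \<in> M"
    proof (rule ccontr)
      assume n: "x ^ q \<notin> M"
      have "x ^ q \<in> L" using saturated_power[OF sat[OF LF] x(1)] .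
      then have "x \<in> adjoin M (x ^ q)" using eq n x by blast
      then obtain j where "x ^ Suc (q * j) \<in> M" unfolding adjoin_def by (auto simp: power_mult)
      then have "x ^ gcd (Suc (q * j)) (q ^ k) \<in> M" using saturated_power_gcd[OF satM _ k] by blast
      moreover have "coprime (Suc (q * j)) (q ^ k)"
        by (metis coprime_Suc_left_nat coprime_commute coprime_mult_left_iff coprime_power_right_iff)
      ultimately show False using x by (simp add: coprime_imp_gcd_eq_1)
    qed
    then show ?thesis using eq x by simp
  qed
  have "\<not> L1 \<subseteq> L2" "\<not> L2 \<subseteq> L1" using anti L by blast+
  then obtain a b where a: "a \<in> L1" "a \<notin> L2" and b: "b \<in> L2" "b \<notin> L1" by blast
  have M_sub: "M \<subset> L1" "M \<subset> L2" "L1 \<subset> N" "L2 \<subset> N" "L1 \<in> F" "L2 \<in> F" using L unfolding between_def by auto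
  have 1: "L1 = adjoin M a" "a ^ q \<in> M" using single[OF L(1) a(1)] a M_sub by blast+
  have 2: "L2 = adjoin M b" "b ^ q \<in> M" using single[OF L(2) b(1)] b M_sub by blast+
  interpret R: rank_two_extension M a b q
    using q satM 1 2 a b M_sub by unfold_locales auto
  have "R.N = N"
  proof (rule ccontr)
    assume ne: "R.N \<noteq> N"
    have "R.N \<subseteq> N" using R.N_subset[OF sat[OF NF]] M_sub a b by blast
    moreover have "L1 \<subset> R.N" using adjoin_superset[of L1 b] b R.b_mem_N unfolding R.N_def 1(1) by blast
    moreover have "R.N \<in> F" unfolding R.N_def using adj MF by blast
    ultimately have "R.N \<in> between F M N" using ne M_sub unfolding between_def by blast
    then show False using anti[OF L(1)] \<open>L1 \<subset> R.N\<close> by blast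
  qed
  then show ?thesis using R.card_between[of F] sat adj[OF MF] card by auto
qed

text \<open>An open submonoid can fail to be saturated, so saturation is demanded only for members
  of exponent \<open>q\<close> over \<open>M\<close>. All of \<open>N\<close> has this exponent, so
  the whole interval is covered.\<close>

lemma antichain_interval_rank_two:
  assumes "rank_two_extension M a b q"
    and "M \<in> F" and adj: "\<And>M a. M \<in> F \<Longrightarrow> adjoin M a \<in> F"
    and sat: "\<And>L. L \<in> F \<Longrightarrow> M \<subseteq> L \<Longrightarrow> (\<And>x. x \<in> L \<Longrightarrow> x ^ q \<in> M) \<Longrightarrow> saturated_submonoid L"
  shows "antichain_interval F (Suc q)"
proof -
  interpret R: rank_two_extension M a b q by fact
  have pow: "x ^ q \<in> M" if xN: "x \<in> R.N" for x
  proof -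
    obtain i j where "x * (a ^ i * b ^ j) \<in> M" using xN[unfolded R.N_iff] by blast
    then have "(x * (a ^ i * b ^ j)) ^ q \<in> M" using saturated_power[OF R.M] by blast
    then have "x ^ q * (a ^ (i * q) * b ^ (j * q)) \<in> M" by (simp add: power_mult_distrib power_mult)
    moreover have "a ^ (i * q) * b ^ (j * q) \<in> M" using R.monomial_mem_iff by simp
    ultimately show ?thesis using saturated_cancel_right[OF R.M] by blast
  qed
  have s: "saturated_submonoid L" if "L \<in> F" "M \<subseteq> L" "L \<subseteq> R.N" for L
    using sat pow that by blast
  have g: "adjoin M (R.gen t) \<in> F" for t using adj \<open>M \<in> F\<close> .
  have "R.N \<in> F" unfolding R.N_def using adj \<open>M \<in> F\<close> by blast
  then show ?thesis unfolding antichain_interval_def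
    using R.card_between[OF s g] R.antichain_between[OF s g] \<open>M \<in> F\<close> by blast
qed

text \<open>The assumptions on the powers say that \<open>a\<close> has order exactly 6 over
  \<open>M\<close>. An intermediate member contains some \<open>a ^ i\<close> outside
  \<open>M\<close>, hence \<open>a ^ gcd i 6\<close>, and only the divisors 2 and 3 are
  possible.\<close>

lemma antichain_interval_cyclic_six:
  fixes M :: "'a::comm_monoid_mult set"
  assumes M: "saturated_submonoid M" and a: "a ^ 6 \<in> M" "a ^ 2 \<notin> M" "a ^ 3 \<notin> M"
    and "M \<in> F" and adj: "\<And>M a. M \<in> F \<Longrightarrow> adjoin M a \<in> F"
    and sat: "\<And>L. L \<in> F \<Longrightarrow> M \<subseteq> L \<Longrightarrow> (\<And>x. x \<in> L \<Longrightarrow> x ^ 6 \<in> M) \<Longrightarrow> saturated_submonoid L"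
  shows "antichain_interval F 2"
proof -
  define N where "N = adjoin M a"
  have gcd6: "gcd i 6 \<in> {1, 2, 3, 6}" for i :: nat
  proof -
    have "d \<in> {1, 2, 3, 6}" if d: "d dvd 6" for d :: nat
    proof -
      have "d \<le> 6" using d by (rule dvd_imp_le) simp
      then consider "d = 0" | "d = 1" | "d = 2" | "d = 3" | "d = 4" | "d = 5" | "d = 6" by linarith
      then show ?thesis using d by cases auto
    qed
    then show ?thesis using gcd_dvd2 by blast
  qed
  have a_iff: "a ^ i \<in> M \<longleftrightarrow> 6 dvd i" for i
  proof
    assume "a ^ i \<in> M"
    then have g: "a ^ gcd i 6 \<in> M" using saturated_power_gcd[OF M] a by blast
    then have "gcd i 6 \<notin> {1, 2, 3}" using a saturated_power[OF M, of a 2] by auto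
    then have "gcd i 6 = 6" using gcd6[of i] by blast
    then show "6 dvd i" by (metis gcd_dvd1)
  next
    assume "6 dvd i" then show "a ^ i \<in> M" using saturated_power_dvd[OF M a(1)] by blast
  qed
  have pow: "x ^ 6 \<in> M" if xN: "x \<in> N" for x
  proof -
    obtain i where "x * a ^ i \<in> M" using xN unfolding N_def adjoin_def by blast
    then have "(x * a ^ i) ^ 6 \<in> M" using saturated_power[OF M] by blast
    then have "x ^ 6 * a ^ (i * 6) \<in> M" by (simp add: power_mult_distrib power_mult)
    moreover have "a ^ (i * 6) \<in> M" using a_iff by simp
    ultimately show ?thesis using saturated_cancel_right[OF M] by blast
  qed
  have aN: "a \<in> N" unfolding N_def using a by (intro mem_adjoin) auto
  have mem: "a ^ i \<in> adjoin M (a ^ d) \<longleftrightarrow> (\<exists>k. 6 dvd i + d * k)" for i d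
    unfolding adjoin_def by (simp add: a_iff flip: power_mult power_add)
  have sub: "adjoin M (a ^ d) \<subseteq> N" for d
    unfolding N_def adjoin_def by (auto simp flip: power_mult)
  have btw: "L = adjoin M (a ^ d)"
    if L: "L \<in> between F M N" and d: "d \<in> {2, 3}" "a ^ d \<in> L" for L d
  proof
    have M_sub: "M \<subset> L" and L_sub: "L \<subset> N" and S: "saturated_submonoid L"
      using L sat pow unfolding between_def by blast+
    show "adjoin M (a ^ d) \<subseteq> L" using adjoin_subset[OF S _ d(2)] M_sub by blast
    show "L \<subseteq> adjoin M (a ^ d)"
    proof
      fix y assume y: "y \<in> L"
      then obtain i where i: "y * a ^ i \<in> M" using L_sub unfolding N_def adjoin_def by blast
      then have "a ^ i \<in> L" using saturated_cancel[OF S y] M_sub by blast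
      then have g: "a ^ gcd d i \<in> L" using saturated_power_gcd[OF S d(2)] by blast
      have "a \<notin> L" using adjoin_subset[OF S, of M a] M_sub L_sub unfolding N_def by blast
      then have "gcd d i \<noteq> 1" using g by auto
      moreover have "prime d" using d(1) by auto
      ultimately have "d dvd i" by (metis coprime_imp_gcd_eq_1 prime_imp_coprime)
      then obtain k where "i = d * k" by auto
      then have "y * (a ^ d) ^ k \<in> M" using i by (simp add: power_mult)
      then show "y \<in> adjoin M (a ^ d)" unfolding adjoin_def by blast
    qed
  qed
  have memd: "a ^ d \<in> adjoin M (a ^ d)" if "d \<in> {2, 3}" for d
    unfolding mem using that by (auto intro: exI[of _ 2] exI[of _ 1])
  have in_btw: "adjoin M (a ^ d) \<in> between F M N" if d: "d \<in> {2, 3}" for d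
  proof -
    have "a ^ d \<notin> M" using d a by auto
    moreover have "a ^ 1 \<notin> adjoin M (a ^ d)" unfolding mem using d by (auto; presburger)
    then have "a \<notin> adjoin M (a ^ d)" by simp
    ultimately show ?thesis unfolding between_def
      using adj \<open>M \<in> F\<close> memd[OF d] sub[of d] adjoin_superset[of M "a ^ d"] aN by blast
  qed
  have "between F M N = {adjoin M (a ^ 2), adjoin M (a ^ 3)}"
  proof
    show "{adjoin M (a ^ 2), adjoin M (a ^ 3)} \<subseteq> between F M N" using in_btw by simp
    show "between F M N \<subseteq> {adjoin M (a ^ 2), adjoin M (a ^ 3)}"
    proof
      fix L assume L: "L \<in> between F M N"
      then have M_sub: "M \<subset> L" and L_sub: "L \<subset> N" and S: "saturated_submonoid L"
        using sat pow unfolding between_def by blast+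
      obtain y where y: "y \<in> L" "y \<notin> M" using M_sub by blast
      then obtain i where i: "y * a ^ i \<in> M" using L_sub unfolding N_def adjoin_def by blast
      have "a ^ i \<notin> M" using saturated_cancel_right[OF M _ i] y by blast
      have "a ^ i \<in> L" using saturated_cancel[OF S y(1)] i M_sub by blast
      then have g: "a ^ gcd i 6 \<in> L" using saturated_power_gcd[OF S _, of a i 6] a(1) M_sub by blast
      have "a \<notin> L" using adjoin_subset[OF S, of M a] M_sub L_sub unfolding N_def by blast
      then have "gcd i 6 \<noteq> 1" using g by auto
      moreover have "gcd i 6 \<noteq> 6" using \<open>a ^ i \<notin> M\<close> a_iff by (metis gcd_dvd1)
      ultimately have "a ^ 2 \<in> L \<or> a ^ 3 \<in> L" using gcd6[of i] g by auto
      then show "L \<in> {adjoin M (a ^ 2), adjoin M (a ^ 3)}" using btw[OF L] by auto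
    qed
  qed
  moreover have "a ^ 2 \<notin> adjoin M (a ^ 3)" unfolding mem by presburger
  then have "adjoin M (a ^ 2) \<noteq> adjoin M (a ^ 3)" using memd[of 2] by auto
  ultimately have c: "card (between F M N) = 2" by simp
  have "A = B" if AB: "A \<in> between F M N" "B \<in> between F M N" "A \<subseteq> B" for A B
  proof -
    obtain d where d: "d \<in> {2, 3}" "A = adjoin M (a ^ d)"
      using AB(1) \<open>between F M N = _\<close> by auto
    then show ?thesis using btw[OF AB(2) d(1)] memd AB(3) by blast
  qed
  moreover have "N \<in> F" unfolding N_def using adj \<open>M \<in> F\<close> .
  ultimately show ?thesis unfolding antichain_interval_def using c \<open>M \<in> F\<close> by blast
qed

section \<open>Open submonoids and the characteristic\<close>

text \<open>The exponent of \<open>M\<close> serves again. If \<open>p\<close> divides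
  \<open>a\<close>, only \<open>i = 0\<close> contributes and nothing is adjoined.\<close>

lemma adjoin_open_submonoids:
  assumes "M \<in> open_submonoids p"
  shows "adjoin M a \<in> open_submonoids p"
  using assms
proof (rule open_submonoidsE)
  fix e
  assume unit: "\<And>u. u dvd 1 \<Longrightarrow> u \<in> M" and mult: "\<And>x y. x \<in> M \<Longrightarrow> y \<in> M \<Longrightarrow> x * y \<in> M"
    and sub: "\<And>x. x \<in> M \<Longrightarrow> \<not> p dvd x" and e: "\<And>x y. x \<in> M \<Longrightarrow> p ^ Suc e dvd y - x \<Longrightarrow> y \<in> M"
  show ?thesis
  proof (rule open_submonoidsI[where e = e])
    show "u \<in> adjoin M a" if "u dvd 1" for u using unit[OF that] adjoin_superset by blast
    fix x assume "x \<in> adjoin M a"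
    then obtain i where i: "x * a ^ i \<in> M" unfolding adjoin_def by blast
    show "\<not> p dvd x" using sub[OF i] dvd_mult2 by blast
    show "y \<in> adjoin M a" if "p ^ Suc e dvd y - x" for y
    proof -
      have "p ^ Suc e dvd (y - x) * a ^ i" using that by (rule dvd_mult2)
      then have "y * a ^ i \<in> M" by (intro e[OF i]) (simp only: left_diff_distrib)
      then show ?thesis unfolding adjoin_def by blast
    qed
    fix y assume "y \<in> adjoin M a"
    then obtain j where j: "y * a ^ j \<in> M" unfolding adjoin_def by blast
    have "(x * a ^ i) * (y * a ^ j) \<in> M" using mult[OF i j] .
    then have "x * y * a ^ (i + j) \<in> M" by (simp add: power_add mult_ac)
    then show "x * y \<in> adjoin M a" unfolding adjoin_def by blast
  qed
qed

lemma ex_inverse_adic: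
  fixes p z :: "'a::euclidean_ring"
  assumes "irreducible p" "\<not> p dvd z"
  obtains s where "p ^ n dvd z * s - 1"
proof -
  obtain r s where rs: "r * p ^ n + s * z = 1"
    using comax_irreducible_power[OF assms] unfolding comax_def by blast
  have "z * s - 1 = p ^ n * (- r)" using rs by (simp add: algebra_simps)
  then show ?thesis using that by (metis dvd_triv_left)
qed

text \<open>Some power \<open>z = x ^ k\<close> lies in \<open>M\<close>, and a
  \<open>p\<close>-adic inverse \<open>s\<close> of \<open>z\<close> belongs to \<open>M\<close> by
  saturation. Multiplying \<open>x * y\<close> by \<open>s * x ^ (k - 1)\<close> recovers
  \<open>y\<close> up to a high power of \<open>p\<close>.\<close>

lemma saturated_open_submonoid:
  fixes p :: "'a::euclidean_ring"
  assumes p: "irreducible p" and M: "M \<in> open_submonoids p" and L: "L \<in> open_submonoids p"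
    and sat: "saturated_submonoid M" and M_sub: "M \<subseteq> L"
    and tors: "\<And>x. x \<in> L \<Longrightarrow> \<exists>k>0. x ^ k \<in> M"
  shows "saturated_submonoid L"
proof -
  obtain d where "\<And>u. u dvd 1 \<Longrightarrow> u \<in> M" "\<And>x y. x \<in> M \<Longrightarrow> y \<in> M \<Longrightarrow> x * y \<in> M"
    and Msub: "\<And>x. x \<in> M \<Longrightarrow> \<not> p dvd x" and d: "\<And>x y. x \<in> M \<Longrightarrow> p ^ Suc d dvd y - x \<Longrightarrow> y \<in> M"
    using M by (rule open_submonoidsE) (rule that)
  obtain e where unit: "\<And>u. u dvd 1 \<Longrightarrow> u \<in> L" and mult: "\<And>x y. x \<in> L \<Longrightarrow> y \<in> L \<Longrightarrow> x * y \<in> L"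
    and "\<And>x. x \<in> L \<Longrightarrow> \<not> p dvd x" and e: "\<And>x y. x \<in> L \<Longrightarrow> p ^ Suc e dvd y - x \<Longrightarrow> y \<in> L"
    using L by (rule open_submonoidsE) (rule that)
  have pow: "x ^ n \<in> L" if "x \<in> L" for x n
    by (induction n) (simp_all add: unit mult that)
  have "y \<in> L" if x: "x \<in> L" and xy: "x * y \<in> L" for x y
  proof -
    obtain k where k: "k > 0" "x ^ k \<in> M" using tors[OF x] by blast
    define z where "z = x ^ k"
    have zM: "z \<in> M" using k z_def by simp
    have "x ^ (k - 1) * (x * y) \<in> L" using mult pow x xy by blast
    then have zy: "z * y \<in> L" using k unfolding z_def by (metis Suc_diff_1 mult.assoc power_Suc2)
    obtain s where s: "p ^ Suc (max d e) dvd z * s - 1" using ex_inverse_adic[OF p Msub[OF zM]] .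
    have "p ^ Suc d dvd z * s - 1" by (rule power_le_dvd[OF s]) simp
    then have "z * s \<in> M" by (rule d[OF saturated_one[OF sat]])
    then have "s \<in> M" using saturated_cancel[OF sat zM] by blast
    then have szy: "s * (z * y) \<in> L" using mult[OF _ zy] M_sub by blast
    have "p ^ Suc e dvd z * s - 1" by (rule power_le_dvd[OF s]) simp
    then have "p ^ Suc e dvd (z * s - 1) * - y" by (rule dvd_mult2)
    moreover have "(z * s - 1) * - y = y - s * (z * y)" by (simp add: algebra_simps)
    ultimately show ?thesis by (intro e[OF szy]) (simp only:)
  qed
  then show ?thesis unfolding saturated_submonoid_def using unit[OF dvd_refl] mult by blast
qed

section \<open>Submonoids given by residues modulo a power of \<open>p\<close>\<close>

definition adic_hull :: "'a::comm_ring_1 \<Rightarrow> nat \<Rightarrow> 'a set \<Rightarrow> 'a set" where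
  "adic_hull p n H = {y. \<exists>h\<in>H. p ^ Suc n dvd y - h}"

text \<open>Products and inverses are required only up to congruence, so \<open>H\<close> may be a
  list of explicit representatives of a group of residues.\<close>

lemma adic_hull_saturated:
  fixes p :: "'a::comm_ring_1"
  assumes unit: "\<And>u. u dvd 1 \<Longrightarrow> u \<in> H"
    and sub: "\<And>h. h \<in> H \<Longrightarrow> \<not> p dvd h"
    and mult: "\<And>g h. g \<in> H \<Longrightarrow> h \<in> H \<Longrightarrow> g * h \<in> adic_hull p n H"
    and inv: "\<And>h. h \<in> H \<Longrightarrow> \<exists>g\<in>H. p ^ Suc n dvd g * h - 1"
  shows "adic_hull p n H \<in> open_submonoids p" "saturated_submonoid (adic_hull p n H)"
proof -
  have cong: "y \<in> adic_hull p n H" if "x \<in> adic_hull p n H" "p ^ Suc n dvd y - x" for x y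
    using that dvd_diff_trans unfolding adic_hull_def by blast
  have HS: "h \<in> adic_hull p n H" if "h \<in> H" for h
    using that unfolding adic_hull_def by (auto intro!: bexI[of _ h])
  have mult': "x * y \<in> adic_hull p n H" if x: "x \<in> adic_hull p n H" and y: "y \<in> adic_hull p n H" for x y
  proof -
    obtain g h where "g \<in> H" "p ^ Suc n dvd x - g" "h \<in> H" "p ^ Suc n dvd y - h"
      using x y unfolding adic_hull_def by blast
    then show ?thesis using cong[OF mult] dvd_diff_mult by blast
  qed
  show "adic_hull p n H \<in> open_submonoids p"
  proof (rule open_submonoidsI[OF _ mult' _ cong])
    show "u \<in> adic_hull p n H" if "u dvd 1" for u using HS unit that by blast
    show "\<not> p dvd x" if x: "x \<in> adic_hull p n H" for x
    proof -
      obtain h where h: "h \<in> H" "p ^ Suc n dvd x - h" using x unfolding adic_hull_def by blast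
      have "p dvd x - h" using power_le_dvd[OF h(2), of 1] by simp
      then show ?thesis using sub[OF h(1)] not_dvd_cong by blast
    qed
  qed
  have "y \<in> adic_hull p n H" if x: "x \<in> adic_hull p n H" and xy: "x * y \<in> adic_hull p n H" for x y
  proof -
    obtain h where h: "h \<in> H" "p ^ Suc n dvd x - h" using x unfolding adic_hull_def by blast
    obtain g where g: "g \<in> H" "p ^ Suc n dvd g * h - 1" using inv[OF h(1)] by blast
    have "p ^ Suc n dvd g * (x - h)" using h(2) by (rule dvd_mult)
    then have "p ^ Suc n dvd (g * h - 1) + g * (x - h)" using g(2) by (intro dvd_add)
    then have "p ^ Suc n dvd ((g * h - 1) + g * (x - h)) * - y" by (rule dvd_mult2)
    moreover have "((g * h - 1) + g * (x - h)) * - y = y - g * (x * y)" by (simp add: algebra_simps)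
    ultimately show ?thesis by (intro cong[OF mult'[OF HS[OF g(1)] xy]]) (simp only:)
  qed
  then show "saturated_submonoid (adic_hull p n H)"
    unfolding saturated_submonoid_def using mult' HS[OF unit[OF dvd_refl]] by blast
qed

lemma adic_hull_units:
  fixes p :: "'a::comm_ring_1"
  assumes "\<not> p dvd 1"
  shows "adic_hull p n {u. u dvd 1} \<in> open_submonoids p"
    "saturated_submonoid (adic_hull p n {u. u dvd 1})"
proof -
  have 1: "\<not> p dvd u" if "u \<in> {u. u dvd 1}" for u using assms that dvd_trans by blast
  have 2: "g * h \<in> adic_hull p n {u. u dvd 1}" if gh: "g \<in> {u. u dvd 1}" "h \<in> {u. u dvd 1}" for g h
  proof -
    have "g * h dvd 1 * 1" using gh by (intro mult_dvd_mono) auto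
    then show ?thesis unfolding adic_hull_def by (auto intro!: exI[of _ "g * h"])
  qed
  have 3: "\<exists>g\<in>{u. u dvd 1}. p ^ Suc n dvd g * h - 1" if h: "h \<in> {u. u dvd 1}" for h
  proof -
    obtain g where "1 = h * g" using h by auto
    then show ?thesis by (intro bexI[of _ g]) (simp add: mult.commute, metis dvd_triv_right mem_Collect_eq)
  qed
  show "adic_hull p n {u. u dvd 1} \<in> open_submonoids p"
    by (rule adic_hull_saturated[OF _ 1 2 3]) simp_all
  show "saturated_submonoid (adic_hull p n {u. u dvd 1})"
    by (rule adic_hull_saturated[OF _ 1 2 3]) simp_all
qed

text \<open>Every polynomial is \<open>c + X * z\<close> with \<open>c\<close> constant, and
  Frobenius gives \<open>x ^ m = c ^ m + X ^ m * z ^ m\<close> for \<open>m\<close> a power of the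
  characteristic. For large \<open>m\<close> this is a unit up to a high power of \<open>X\<close>,
  so everything prime to \<open>X\<close> is torsion of prime power order over each open
  submonoid.\<close>

lemma antichain_interval_X:
  assumes q: "CHAR('k::field) > 0"
    and m: "antichain_interval (open_submonoids [:0, 1 :: 'k:]) m" "m \<ge> 2"
  shows "m = Suc CHAR('k)"
proof -
  define X where "X = [:0, 1 :: 'k:]"
  have X: "irreducible X" unfolding X_def by (rule irreducible_linear_field_poly) simp
  have prime: "prime CHAR('k)" using q by (rule prime_CHAR_semidom)
  have tors: "\<exists>k. x ^ (CHAR('k) ^ k) \<in> M" if M: "M \<in> open_submonoids X" and x: "\<not> X dvd x" for M x
    using M
  proof (rule open_submonoidsE)
    fix e
    assume unit: "\<And>u. u dvd 1 \<Longrightarrow> u \<in> M" and e: "\<And>x y. x \<in> M \<Longrightarrow> X ^ Suc e dvd y - x \<Longrightarrow> y \<in> M"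
    obtain c z where cz: "x = pCons c z" by (cases x)
    then have xz: "x = [:c:] + X * z" unfolding X_def by simp
    have "c \<noteq> 0" using x xz by auto
    define m where "m = CHAR('k) ^ Suc e"
    have "x ^ m = [:c:] ^ m + (X * z) ^ m"
      unfolding xz by (rule freshmans_dream'[where n = "Suc e"]) (use prime in \<open>simp_all add: m_def\<close>)
    then have "x ^ m - [:c:] ^ m = X ^ m * z ^ m" by (simp add: power_mult_distrib)
    moreover have "Suc e \<le> m"
      unfolding m_def using power_gt_expt[of "CHAR('k)" "Suc e"] prime_gt_1_nat[OF prime] by simp
    then have "X ^ Suc e dvd X ^ m" by (rule le_imp_power_dvd)
    ultimately have "X ^ Suc e dvd x ^ m - [:c:] ^ m" by simp
    moreover have "[:c:] ^ m dvd 1" using \<open>c \<noteq> 0\<close> by (simp add: is_unit_power_iff is_unit_triv)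
    ultimately have "x ^ m \<in> M" using e[OF unit] by blast
    then show ?thesis unfolding m_def by blast
  qed
  have notX: "\<not> X dvd x" if "L \<in> open_submonoids X" "x \<in> L" for L x
    using that unfolding open_submonoids_def by simp
  have sat: "saturated_submonoid L" if L: "L \<in> open_submonoids X" for L
  proof -
    obtain e where unit: "\<And>u. u dvd 1 \<Longrightarrow> u \<in> L" and "\<And>x y. x \<in> L \<Longrightarrow> y \<in> L \<Longrightarrow> x * y \<in> L"
      and "\<And>x. x \<in> L \<Longrightarrow> \<not> X dvd x" and e: "\<And>x y. x \<in> L \<Longrightarrow> X ^ Suc e dvd y - x \<Longrightarrow> y \<in> L"
      using L by (rule open_submonoidsE) (rule that)
    have X1: "\<not> X dvd 1" using X by (auto simp: irreducible_def)
    show ?thesis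
    \<comment> \<open>Saturation is transferred from the hull of the constants modulo
      \<open>X ^ Suc e\<close>, which is contained in \<open>L\<close>.\<close>
    proof (rule saturated_open_submonoid[OF X adic_hull_units(1)[OF X1] L adic_hull_units(2)[OF X1]])
      show "adic_hull X e {u. u dvd 1} \<subseteq> L"
        unfolding adic_hull_def using e[OF unit] by blast
      fix x assume "x \<in> L"
      then show "\<exists>k>0. x ^ k \<in> adic_hull X e {u. u dvd 1}"
        using tors[OF adic_hull_units(1)[OF X1] notX[OF L]] q by (meson zero_less_power)
    qed
  qed
  show ?thesis
  proof (rule antichain_interval_prime[OF prime sat _ adjoin_open_submonoids])
    show "\<exists>k. x ^ (CHAR('k) ^ k) \<in> M" if "M \<in> open_submonoids X" "L \<in> open_submonoids X" "x \<in> L" for L M x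
      using tors[OF that(1) notX[OF that(2,3)]] .
  qed (use m in \<open>simp_all add: X_def\<close>)
qed

lemma power_first_order:
  fixes p c :: "'a::comm_ring_1"
  shows "p ^ 2 dvd (1 + c * p) ^ i - (1 + of_nat i * c * p)"
proof (induction i)
  case (Suc i)
  have "(1 + c * p) ^ Suc i - (1 + of_nat (Suc i) * c * p) =
      (1 + c * p) * ((1 + c * p) ^ i - (1 + of_nat i * c * p)) + p ^ 2 * (of_nat i * c ^ 2)"
    by (simp add: algebra_simps power2_eq_square)
  then show ?case using Suc by (metis dvd_add dvd_mult dvd_triv_left)
qed simp

text \<open>Reduction modulo \<open>p\<close> makes the constant \<open>1 - u\<close> a multiple of
  the non-unit \<open>p\<close>, hence zero. So dividing by the constants does not identify distinct
  one-units modulo \<open>p ^ 2\<close>.\<close>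

lemma unit_first_order:
  fixes p z u :: "'k::field poly"
  assumes p: "irreducible p" and u: "u dvd 1" and d: "p ^ 2 dvd (1 + z * p) - u"
  shows "u = 1" "p dvd z"
proof -
  have p1: "\<not> p dvd 1" "p \<noteq> 0" using p by (auto simp: irreducible_def)
  have "p dvd (1 + z * p) - u" using power_le_dvd[OF d, of 1] by simp
  then have "p dvd ((1 + z * p) - u) - z * p" by (rule dvd_diff) simp
  then have "p dvd 1 - u" by (simp add: algebra_simps)
  moreover have "degree (1 - u) = 0"
    using u by (metis poly_unit_degree degree_1 degree_diff_le le_zero_eq max.idem)
  ultimately show u1: "u = 1" using p1 by (metis dvd_trans poly_unit_degree eq_iff_diff_eq_0)
  have "p * p dvd p * z" using d unfolding u1 by (simp add: power2_eq_square mult.commute)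
  then show "p dvd z" using p1 by simp
qed

text \<open>The one-units modulo \<open>p ^ 2\<close> form a copy of the additive group of residues
  modulo \<open>p\<close>, of exponent \<open>CHAR('k)\<close>. There 1 and a constant
  \<open>t\<close> outside the prime field are independent; \<open>a\<close> and \<open>b\<close>
  are the corresponding one-units.\<close>

lemma antichain_interval_pos_char:
  fixes p :: "'k::field poly"
  assumes inf: "infinite (UNIV :: 'k set)" and p: "irreducible p" and l: "CHAR('k) > 0"
  shows "antichain_interval (open_submonoids p) (Suc CHAR('k))"
proof -
  have prime: "prime CHAR('k)" using l by (rule prime_CHAR_semidom)
  have p1: "\<not> p dvd 1" "p \<noteq> 0" using p by (auto simp: irreducible_def)
  define M where "M = adic_hull p 1 {u. u dvd 1}"
  have M: "M \<in> open_submonoids p" "saturated_submonoid M"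
    unfolding M_def using adic_hull_units p1 by blast+
  have M_iff: "y \<in> M \<longleftrightarrow> (\<exists>u. u dvd 1 \<and> p ^ 2 dvd y - u)" for y
    unfolding M_def adic_hull_def by (simp add: numeral_2_eq_2)
  \<comment> \<open>The excluded values make up the prime field, written with a minus sign so that
    \<open>t + of_nat i\<close> never vanishes.\<close>
  have "finite ((\<lambda>i. - of_nat i :: 'k) ` {..<CHAR('k)})" by simp
  then obtain t :: 'k where t: "t \<notin> (\<lambda>i. - of_nat i) ` {..<CHAR('k)}" using inf by (meson ex_new_if_finite)
  have t': "t + of_nat i \<noteq> 0" for i
  proof
    assume "t + of_nat i = 0"
    then have "t = - of_nat i" by (simp add: eq_neg_iff_add_eq_0)
    moreover have "of_nat i = (of_nat (i div CHAR('k) * CHAR('k) + i mod CHAR('k)) :: 'k)"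
      by (simp only: div_mult_mod_eq)
    then have "of_nat i = (of_nat (i mod CHAR('k)) :: 'k)" unfolding of_nat_add of_nat_mult of_nat_CHAR by simp
    moreover have "i mod CHAR('k) \<in> {..<CHAR('k)}" using l by simp
    ultimately show False using t by (metis imageI)
  qed
  define a where "a = 1 + 1 * p"
  define b where "b = 1 + [:t:] * p"
  have pow: "(1 + c * p) ^ CHAR('k) \<in> M" for c
  proof -
    have "of_nat CHAR('k) = (0 :: 'k poly)" by (metis of_nat_CHAR semiring_char_poly)
    then have "p ^ 2 dvd (1 + c * p) ^ CHAR('k) - 1"
      using power_first_order[of p c "CHAR('k)"] by (simp only: mult_zero_left add_0_right)
    then show ?thesis unfolding M_iff by (intro exI[of _ 1]) simp
  qed
  have "a \<notin> M"
  proof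
    assume "a \<in> M"
    then obtain u where "u dvd 1" "p ^ 2 dvd (1 + 1 * p) - u" unfolding M_iff a_def by blast
    then show False using unit_first_order(2)[OF p] p1 by blast
  qed
  moreover have "b \<notin> adjoin M a"
  proof
    assume "b \<in> adjoin M a"
    then obtain i u where u: "u dvd 1" "p ^ 2 dvd b * a ^ i - u" unfolding adjoin_def M_iff by blast
    have "p ^ 2 dvd (1 + of_nat i * 1 * p) - a ^ i"
      using power_first_order[of p 1 i] unfolding a_def by (simp only: dvd_diff_commute)
    then have "p ^ 2 dvd b * (1 + of_nat i * 1 * p) - b * a ^ i" 
      unfolding right_diff_distrib[symmetric] by (rule dvd_mult)
    then have "p ^ 2 dvd b * (1 + of_nat i * 1 * p) - u" by (rule dvd_diff_trans[OF u(2)])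
    \<comment> \<open>Removing the second-order term leaves the one-unit belonging to
      \<open>t + i\<close>.\<close>
    then have "p ^ 2 dvd (b * (1 + of_nat i * 1 * p) - u) - p ^ 2 * ([:t:] * of_nat i)"
      by (rule dvd_diff) (rule dvd_triv_left)
    also have "(b * (1 + of_nat i * 1 * p) - u) - p ^ 2 * ([:t:] * of_nat i)
        = (1 + ([:t:] + of_nat i) * p) - u"
      unfolding b_def by (simp add: algebra_simps power2_eq_square)
    finally have "p dvd [:t:] + of_nat i" by (rule unit_first_order(2)[OF p u(1)])
    then have "p dvd [:t + of_nat i:]" by (simp add: of_nat_poly)
    then show False using t' p1 by (metis dvd_trans is_unit_triv)
  qed
  ultimately have "rank_two_extension M a b CHAR('k)"
    using prime M pow[of 1] pow[of "[:t:]"] unfolding a_def b_def by unfold_locales auto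
  then show ?thesis
    using M(1) adjoin_open_submonoids
  proof (rule antichain_interval_rank_two)
    fix L assume L: "L \<in> open_submonoids p" "M \<subseteq> L" "\<And>x. x \<in> L \<Longrightarrow> x ^ CHAR('k) \<in> M"
    then show "saturated_submonoid L" using saturated_open_submonoid[OF p M(1) L(1) M(2)] l by blast
  qed
qed

text \<open>In characteristic zero the integers embed into the residues modulo \<open>p\<close>, so
  \<open>a = 1 + p\<close> has infinite order modulo \<open>p ^ 2\<close> and the constants. Putting
  the multiples of 6 into \<open>M\<close> gives it order 6 over \<open>M\<close>.\<close>

lemma antichain_interval_char_0:
  fixes p :: "'k::field poly"
  assumes p: "irreducible p" and l: "CHAR('k) = 0"
  shows "antichain_interval (open_submonoids p) 2"
proof -
  have p1: "\<not> p dvd 1" "p \<noteq> 0" using p by (auto simp: irreducible_def)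
  \<comment> \<open>Letting \<open>k\<close> range over all integers makes inverses modulo
    \<open>p ^ 2\<close> available, as saturation requires.\<close>
  define H where "H = {u * (1 + of_int (6 * k) * p) | u k. u dvd 1}"
  have HI: "u * (1 + of_int (6 * k) * p) \<in> H" if "u dvd 1" for u k
    unfolding H_def using that by blast
  define M where "M = adic_hull p 1 H"
  have p2: "p ^ Suc 1 = p ^ 2" by (simp add: numeral_2_eq_2)
  have 1: "u \<in> H" if "u dvd 1" for u using HI[OF that, of 0] by simp
  have 2: "\<not> p dvd h" if hH: "h \<in> H" for h
  proof
    assume ph: "p dvd h"
    obtain u k where h: "h = u * (1 + of_int (6 * k) * p)" "u dvd 1" using hH unfolding H_def by blast
    have "\<not> p dvd u" using p1 h dvd_trans by blast
    then have "p dvd 1 + of_int (6 * k) * p" using irreducible_dvd_multD[OF p] ph h by blast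
    then have "p dvd (1 + of_int (6 * k) * p) - of_int (6 * k) * p" by (rule dvd_diff) simp
    then show False using p1 by simp
  qed
  have 3: "g * h \<in> adic_hull p 1 H" if gh: "g \<in> H" "h \<in> H" for g h
  proof -
    obtain u k where g: "g = u * (1 + of_int (6 * k) * p)" "u dvd 1" using gh unfolding H_def by blast
    obtain v j where h: "h = v * (1 + of_int (6 * j) * p)" "v dvd 1" using gh unfolding H_def by blast
    have "g * h - u * v * (1 + of_int (6 * (k + j)) * p) = p ^ 2 * (u * v * of_int (6 * k) * of_int (6 * j))"
      unfolding g h by (simp add: algebra_simps power2_eq_square)
    then have "p ^ Suc 1 dvd g * h - u * v * (1 + of_int (6 * (k + j)) * p)" unfolding p2 by simp
    moreover have "u * v dvd 1" using mult_dvd_mono[OF g(2) h(2)] by simp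
    ultimately show ?thesis unfolding adic_hull_def using HI by blast
  qed
  have 4: "\<exists>g\<in>H. p ^ Suc 1 dvd g * h - 1" if hH: "h \<in> H" for h
  proof -
    obtain u k where h: "h = u * (1 + of_int (6 * k) * p)" "u dvd 1" using hH unfolding H_def by blast
    obtain v where v: "1 = u * v" using h by auto
    define g where "g = v * (1 + of_int (6 * - k) * p)"
    have "g * h = (u * v) * ((1 + of_int (6 * - k) * p) * (1 + of_int (6 * k) * p))"
      unfolding g_def h by (simp only: mult_ac)
    then have "g * h - 1 = p ^ 2 * (- (of_int (6 * k) * of_int (6 * k)))"
      unfolding v[symmetric] by (simp add: algebra_simps power2_eq_square)
    moreover have "g \<in> H" unfolding g_def using v by (intro HI) (metis dvd_triv_right)
    ultimately show ?thesis unfolding p2 by (metis dvd_triv_left)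
  qed
  have M: "M \<in> open_submonoids p" "saturated_submonoid M"
    unfolding M_def using adic_hull_saturated[OF 1 2 3 4] by blast+
  define a where "a = 1 + 1 * p"
  have fo: "p ^ 2 dvd a ^ i - (1 + of_nat i * 1 * p)" for i unfolding a_def by (rule power_first_order)
  have inj: "6 dvd i" if "a ^ i \<in> M" for i
  proof -
    obtain u k where u: "u dvd 1" "p ^ 2 dvd a ^ i - u * (1 + of_int (6 * k) * p)"
      using \<open>a ^ i \<in> M\<close> unfolding M_def adic_hull_def H_def p2 by blast
    have "p ^ 2 dvd u * (1 + of_int (6 * k) * p) - (1 + of_nat i * 1 * p)"
      using dvd_diff_trans[OF fo] u(2) by (metis dvd_diff_commute)
    then have "p ^ 2 dvd (1 + of_nat i * 1 * p) - u * (1 + of_int (6 * k) * p)"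
      by (simp only: dvd_diff_commute)
    also have "(1 + of_nat i * 1 * p) - u * (1 + of_int (6 * k) * p)
        = (1 + (of_nat i - u * of_int (6 * k)) * p) - u" by (simp add: algebra_simps)
    finally have "u = 1" "p dvd of_nat i - u * of_int (6 * k)" using unit_first_order[OF p u(1)] by blast+
    then have "p dvd of_int (int i - 6 * k)" by simp
    \<comment> \<open>A nonzero constant is a unit and cannot be divisible by
      \<open>p\<close>.\<close>
    then have "(of_int (int i - 6 * k) :: 'k poly) = 0"
      using p1 by (metis dvd_trans poly_unit_degree degree_of_int)
    then have "int i = 6 * k" using l by (simp only: of_int_eq_0_iff_char_dvd semiring_char_poly) simp
    then show ?thesis by presburger
  qed
  have "a ^ 6 \<in> M"
  proof -
    have "1 * (1 + of_int (6 * 1) * p) \<in> H" by (rule HI) simp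
    moreover have "p ^ Suc 1 dvd a ^ 6 - 1 * (1 + of_int (6 * 1) * p)" using fo[of 6] unfolding p2 by simp
    ultimately show ?thesis unfolding M_def adic_hull_def by blast
  qed
  moreover have "a ^ 2 \<notin> M" "a ^ 3 \<notin> M" using inj[of 2] inj[of 3] by auto
  ultimately show ?thesis
    using M(1) adjoin_open_submonoids
  proof (rule antichain_interval_cyclic_six[OF M(2)])
    fix L assume L: "L \<in> open_submonoids p" "M \<subseteq> L" "\<And>x. x \<in> L \<Longrightarrow> x ^ 6 \<in> M"
    then show "saturated_submonoid L"
      using saturated_open_submonoid[OF p M(1) L(1) M(2)] by (metis zero_less_numeral)
  qed
qed

section \<open>Invariance under homeomorphisms\<close>

lemma homeomorphic_maps_image_eq:
  assumes "homeomorphic_maps X Y f g" "C \<subseteq> topspace Y"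
  shows "f ` g ` C = C" "g ` C \<subseteq> topspace X"
  using assms unfolding homeomorphic_maps_def continuous_map_def Pi_iff
  by (force simp: image_image)+

lemma homeomorphic_maps_inj_on: "homeomorphic_maps X Y f g \<Longrightarrow> inj_on f (topspace X)"
  unfolding homeomorphic_maps_def by (metis inj_onI)

lemma homeomorphic_maps_image_topspace: "homeomorphic_maps X Y f g \<Longrightarrow> f ` topspace X = topspace Y"
  using homeomorphic_imp_surjective_map homeomorphic_maps_map by blast

lemma homeomorphic_maps_openin_image:
  "homeomorphic_maps X Y f g \<Longrightarrow> openin X U \<Longrightarrow> openin Y (f ` U)"
  using homeomorphic_map_openness_eq homeomorphic_maps_map by blast

lemma homeomorphic_maps_closure_image:
  "homeomorphic_maps X Y f g \<Longrightarrow> openin X U \<Longrightarrow> Y closure_of (f ` U) = f ` (X closure_of U)"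
  using homeomorphic_map_closure_of homeomorphic_maps_map openin_subset by metis

text \<open>The definition involves only open sets and closures of open sets. Test sets are pulled
  back along \<open>g\<close>, and injectivity of \<open>f\<close> on the space lets images commute
  with intersections.\<close>

lemma closure_le_homeomorphic_imp:
  assumes h: "homeomorphic_maps X Y f g" and x: "x \<in> topspace X" and y: "y \<in> topspace X"
    and le: "closure_le X x y"
  shows "closure_le Y (f x) (f y)"
  unfolding closure_le_def
proof (intro allI impI, elim conjE)
  fix U V assume U: "openin Y U" "f y \<in> U" and V: "openin Y V" "V \<noteq> {}"
  have h': "homeomorphic_maps Y X g f" using h homeomorphic_maps_sym by blast
  have gU: "openin X (g ` U)" "openin X (g ` V)" using homeomorphic_maps_openin_image[OF h'] U V by blast+
  have "g (f y) = y" using h y unfolding homeomorphic_maps_def by blast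
  then have "y \<in> g ` U" using U by (metis imageI)
  moreover have "g ` V \<noteq> {}" using V by blast
  ultimately have "\<exists>U' V'. openin X U' \<and> x \<in> U' \<and> openin X V' \<and> V' \<noteq> {} \<and>
      X closure_of U' \<inter> X closure_of V' \<subseteq> X closure_of (g ` U) \<inter> X closure_of (g ` V)"
    using gU by (intro le[unfolded closure_le_def, rule_format]) simp
  then obtain U' V' where U': "openin X U'" "x \<in> U'" and V': "openin X V'" "V' \<noteq> {}"
    and cl: "X closure_of U' \<inter> X closure_of V' \<subseteq> X closure_of (g ` U) \<inter> X closure_of (g ` V)"
    by (elim exE conjE) (rule that)
  have eq: "f ` g ` U = U" "f ` g ` V = V"
    by (rule homeomorphic_maps_image_eq(1)[OF h openin_subset[OF U(1)]],
        rule homeomorphic_maps_image_eq(1)[OF h openin_subset[OF V(1)]])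
  have "Y closure_of (f ` U') \<inter> Y closure_of (f ` V') = f ` (X closure_of U' \<inter> X closure_of V')"
    unfolding homeomorphic_maps_closure_image[OF h U'(1)] homeomorphic_maps_closure_image[OF h V'(1)]
    by (rule inj_on_image_Int[OF homeomorphic_maps_inj_on[OF h], symmetric]) (rule closure_of_subset_topspace)+
  also have "\<dots> \<subseteq> f ` (X closure_of (g ` U)) \<inter> f ` (X closure_of (g ` V))" using cl by blast
  also have "\<dots> = Y closure_of U \<inter> Y closure_of V"
    unfolding homeomorphic_maps_closure_image[OF h gU(1), symmetric]
      homeomorphic_maps_closure_image[OF h gU(2), symmetric] eq ..
  finally show "\<exists>U' V'. openin Y U' \<and> f x \<in> U' \<and> openin Y V' \<and> V' \<noteq> {} \<and>
      Y closure_of U' \<inter> Y closure_of V' \<subseteq> Y closure_of U \<inter> Y closure_of V"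
    using U' V' homeomorphic_maps_openin_image[OF h] by (intro exI[of _ "f ` U'"] exI[of _ "f ` V'"]) auto
qed

lemma closure_le_homeomorphic:
  assumes h: "homeomorphic_maps X Y f g" and x: "x \<in> topspace X" and y: "y \<in> topspace X"
  shows "closure_le Y (f x) (f y) \<longleftrightarrow> closure_le X x y"
proof
  assume "closure_le Y (f x) (f y)"
  moreover have "f x \<in> topspace Y" "f y \<in> topspace Y"
    using homeomorphic_maps_image_topspace[OF h] x y by blast+
  ultimately have "closure_le X (g (f x)) (g (f y))"
    using closure_le_homeomorphic_imp h homeomorphic_maps_sym by metis
  then show "closure_le X x y" using h x y unfolding homeomorphic_maps_def by metis
qed (rule closure_le_homeomorphic_imp[OF assms])

lemma prime_sets_homeomorphic:
  assumes h: "homeomorphic_maps X Y f g" and S: "S \<in> prime_sets X"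
  shows "f ` S \<in> prime_sets Y"
proof -
  obtain x where S: "S = {y \<in> topspace X. closure_le X x y}" and x: "x \<in> topspace X"
    and nb: "\<exists>y\<in>topspace X. \<not> closure_le X x y"
    and min: "\<forall>y\<in>topspace X. closure_le X y x \<longrightarrow>
        closure_le X x y \<or> (\<forall>z\<in>topspace X. closure_le X y z)"
    using S unfolding prime_sets_def by blast
  have top: "topspace Y = f ` topspace X" using homeomorphic_maps_image_topspace[OF h] ..
  note le = closure_le_homeomorphic[OF h]
  have "f ` S = {y \<in> topspace Y. closure_le Y (f x) y}"
    unfolding S top using le[OF x] by blast
  moreover have "\<exists>y\<in>topspace Y. \<not> closure_le Y (f x) y" unfolding top using nb le[OF x] by blast
  moreover have "\<forall>y\<in>topspace Y. closure_le Y y (f x) \<longrightarrow>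
        closure_le Y (f x) y \<or> (\<forall>z\<in>topspace Y. closure_le Y y z)"
    unfolding top using min x by (simp add: le)
  ultimately show ?thesis unfolding prime_sets_def using x top by blast
qed

lemma clopen_off_homeomorphic:
  assumes h: "homeomorphic_maps X Y f g" and P: "P \<subseteq> topspace X" and M: "clopen_off X P M"
  shows "clopen_off Y (f ` P) (f ` M)"
proof -
  have sub: "M \<subseteq> topspace X - P" using M unfolding clopen_off_def by blast
  note inj = homeomorphic_maps_inj_on[OF h]
  have D: "f ` (topspace X - P) = topspace Y - f ` P"
    using inj_on_image_set_diff[OF inj _ P] homeomorphic_maps_image_topspace[OF h] by auto
  have "f ` (topspace X - P - M) = topspace Y - f ` P - f ` M"
    unfolding D[symmetric] using sub by (intro inj_on_image_set_diff[OF inj]) auto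
  moreover have "f ` M \<subseteq> topspace Y - f ` P" unfolding D[symmetric] using sub by blast
  ultimately show ?thesis
    using M homeomorphic_maps_openin_image[OF h] unfolding clopen_off_def by metis
qed

text \<open>The family \<open>D\<close> is carried over member by member; minimality is checked by
  pulling each competing clopen set back along \<open>g\<close>.\<close>

lemma generated_clopens_homeomorphic_imp:
  assumes h: "homeomorphic_maps X Y f g" and P: "P \<subseteq> topspace X" and M: "M \<in> generated_clopens X P"
  shows "f ` M \<in> generated_clopens Y (f ` P)"
proof -
  have clM: "clopen_off X P M" using M unfolding generated_clopens_def by blast
  have "\<exists>D. D \<subseteq> prime_sets X \<and> topspace X - \<Union>D \<subseteq> M \<and>
        (\<forall>C. clopen_off X P C \<and> topspace X - \<Union>D \<subseteq> C \<longrightarrow> M \<subseteq> C)"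
    using M unfolding generated_clopens_def by blast
  then obtain D where D: "D \<subseteq> prime_sets X" "topspace X - \<Union>D \<subseteq> M"
    and least: "\<And>C. clopen_off X P C \<Longrightarrow> topspace X - \<Union>D \<subseteq> C \<Longrightarrow> M \<subseteq> C" by (elim exE conjE) simp
  have h': "homeomorphic_maps Y X g f" using h homeomorphic_maps_sym by blast
  have "\<Union>D \<subseteq> topspace X" using D(1) unfolding prime_sets_def by blast
  then have E: "topspace Y - \<Union>((`) f ` D) = f ` (topspace X - \<Union>D)"
    unfolding image_Union[symmetric] homeomorphic_maps_image_topspace[OF h, symmetric]
    by (intro inj_on_image_set_diff[OF homeomorphic_maps_inj_on[OF h], symmetric]) auto
  have "f ` M \<subseteq> C" if C: "clopen_off Y (f ` P) C" "f ` (topspace X - \<Union>D) \<subseteq> C" for C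
  proof -
    have fP: "f ` P \<subseteq> topspace Y" using P homeomorphic_maps_image_topspace[OF h] by blast
    have gf: "g ` f ` S = S" if "S \<subseteq> topspace X" for S using homeomorphic_maps_image_eq(1)[OF h' that] .
    have "clopen_off X P (g ` C)" using clopen_off_homeomorphic[OF h' fP C(1)] gf[OF P] by simp
    moreover have "topspace X - \<Union>D \<subseteq> g ` C" using C(2) gf[of "topspace X - \<Union>D"] by blast
    ultimately have "M \<subseteq> g ` C" by (rule least)
    moreover have "C \<subseteq> topspace Y" using C(1) unfolding clopen_off_def by blast
    then have "f ` g ` C = C" using homeomorphic_maps_image_eq(1)[OF h] by blast
    ultimately show ?thesis by blast
  qed
  moreover have "(`) f ` D \<subseteq> prime_sets Y" using prime_sets_homeomorphic[OF h] D(1) by blast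
  moreover have "f ` (topspace X - \<Union>D) \<subseteq> f ` M" using D(2) by blast
  ultimately show ?thesis
    unfolding generated_clopens_def mem_Collect_eq
    by (intro conjI clopen_off_homeomorphic[OF h P clM] exI[of _ "(`) f ` D"] allI impI) (simp_all only: E)
qed

lemma generated_clopens_homeomorphic:
  assumes h: "homeomorphic_maps X Y f g" and P: "P \<subseteq> topspace X"
  shows "generated_clopens Y (f ` P) = (`) f ` generated_clopens X P"
proof
  show "(`) f ` generated_clopens X P \<subseteq> generated_clopens Y (f ` P)"
    using generated_clopens_homeomorphic_imp[OF assms] by blast
  show "generated_clopens Y (f ` P) \<subseteq> (`) f ` generated_clopens X P"
  proof
    fix M assume M: "M \<in> generated_clopens Y (f ` P)"
    have h': "homeomorphic_maps Y X g f" using h homeomorphic_maps_sym by blast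
    have fP: "f ` P \<subseteq> topspace Y" using P homeomorphic_maps_image_topspace[OF h] by blast
    have "g ` M \<in> generated_clopens X P"
      using generated_clopens_homeomorphic_imp[OF h' fP M] homeomorphic_maps_image_eq(1)[OF h' P] by simp
    moreover have "M \<subseteq> topspace Y" using M unfolding generated_clopens_def clopen_off_def by blast
    then have "M = f ` g ` M" using homeomorphic_maps_image_eq(1)[OF h] by simp
    ultimately show "M \<in> (`) f ` generated_clopens X P" by blast
  qed
qed

text \<open>On subsets of \<open>T\<close> the image map is an order embedding, so it carries
  intervals to intervals of the same size.\<close>

lemma antichain_interval_image:
  assumes inj: "inj_on f T" and F: "\<And>A. A \<in> F \<Longrightarrow> A \<subseteq> T" and m: "antichain_interval ((`) f ` F) m"
  shows "antichain_interval F m"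
proof -
  have le: "f ` A \<subseteq> f ` B \<longleftrightarrow> A \<subseteq> B" if "A \<in> F" "B \<in> F" for A B
    using inj_on_image_subset_iff[OF inj] F that by blast
  obtain M N where MN: "M \<in> F" "N \<in> F" and card: "card (between ((`) f ` F) (f ` M) (f ` N)) = m"
    and anti: "\<forall>A\<in>between ((`) f ` F) (f ` M) (f ` N). \<forall>B\<in>between ((`) f ` F) (f ` M) (f ` N). A \<subseteq> B \<longrightarrow> A = B"
    using m unfolding antichain_interval_def by auto
  have btw: "between ((`) f ` F) (f ` M) (f ` N) = (`) f ` between F M N"
  proof -
    have less: "f ` A \<subset> f ` B \<longleftrightarrow> A \<subset> B" if "A \<in> F" "B \<in> F" for A B
      using le that unfolding less_le_not_le by blast
    show ?thesis
    proof (intro set_eqI iffI)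
      fix B assume "B \<in> between ((`) f ` F) (f ` M) (f ` N)"
      then have B: "B \<in> (`) f ` F" "f ` M \<subset> B" "B \<subset> f ` N" unfolding between_def by simp_all
      then obtain A where "A \<in> F" "B = f ` A" by blast
      with B show "B \<in> (`) f ` between F M N" unfolding between_def using less MN by simp
    next
      fix B assume "B \<in> (`) f ` between F M N"
      then obtain A where A: "A \<in> F" "M \<subset> A" "A \<subset> N" "B = f ` A" unfolding between_def by blast
      then have "f ` M \<subset> B" "B \<subset> f ` N" using less MN by simp_all
      then show "B \<in> between ((`) f ` F) (f ` M) (f ` N)" unfolding between_def using A by simp
    qed
  qed
  have "inj_on ((`) f) (between F M N)"
    by (rule inj_onI) (metis (no_types, lifting) between_def le mem_Collect_eq order_refl subset_antisym)
  then have "card (between F M N) = m" using card unfolding btw by (simp add: card_image)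
  moreover have "A = B" if "A \<in> between F M N" "B \<in> between F M N" "A \<subseteq> B" for A B
  proof -
    have "f ` A = f ` B" using anti that unfolding btw by (meson imageI image_mono)
    then have "f ` A \<subseteq> f ` B" "f ` B \<subseteq> f ` A" by auto
    then show ?thesis using le that unfolding between_def by blast
  qed
  ultimately show ?thesis unfolding antichain_interval_def using MN by blast
qed

text \<open>The multiples of \<open>X\<close> go to those of some irreducible \<open>p\<close> about
  which nothing more is known. The interval exhibited at \<open>p\<close> is pulled back to
  \<open>X\<close>, where its size must be \<open>Suc CHAR('k)\<close>; the size 2 would force
  \<open>CHAR('k) = 1\<close>.\<close>

lemma CHAR_eq_if_CHAR_pos:
  assumes K: "infinite (UNIV :: 'k::field set)" "dirichlet_field TYPE('k)"
    and L: "infinite (UNIV :: 'l::field set)" "dirichlet_field TYPE('l)"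
    and homeo: "(golomb_topology :: 'k poly topology) homeomorphic_space (golomb_topology :: 'l poly topology)"
    and pos: "CHAR('k) > 0"
  shows "CHAR('k) = CHAR('l)"
proof -
  obtain f :: "'k poly \<Rightarrow> 'l poly" and g where h: "homeomorphic_maps golomb_topology golomb_topology f g"
    using homeo unfolding homeomorphic_space_def by blast
  define X where "X = [:0, 1 :: 'k:]"
  define P where "P = {y. y \<noteq> 0 \<and> X dvd y}"
  have X: "irreducible X" unfolding X_def by (rule irreducible_linear_field_poly) simp
  then have "P \<in> prime_sets golomb_topology" unfolding prime_sets_golomb[OF K(1)] P_def by blast
  then have "f ` P \<in> prime_sets golomb_topology" by (rule prime_sets_homeomorphic[OF h])
  then obtain p where p: "irreducible p" "f ` P = {y. y \<noteq> 0 \<and> p dvd y}"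
    unfolding prime_sets_golomb[OF L(1)] by blast
  have P_sub: "P \<subseteq> topspace golomb_topology" unfolding P_def topspace_golomb_topology by auto
  have F: "open_submonoids p = (`) f ` open_submonoids X"
    using generated_clopens_homeomorphic[OF h P_sub]
    unfolding p(2) generated_clopens_golomb[OF L p(1)] generated_clopens_golomb[OF K X, folded P_def] .
  have down: "m = Suc CHAR('k)" if "antichain_interval (open_submonoids p) m" "m \<ge> 2" for m
  proof (rule antichain_interval_X[OF pos _ that(2)])
    have "A \<subseteq> topspace golomb_topology" if "A \<in> open_submonoids X" for A
      using that unfolding open_submonoids_def topspace_golomb_topology by auto
    then show "antichain_interval (open_submonoids [:0, 1 :: 'k:]) m"
      using antichain_interval_image[OF homeomorphic_maps_inj_on[OF h]] that(1) unfolding F X_def by blast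
  qed
  have prime: "prime CHAR('k)" using pos by (rule prime_CHAR_semidom)
  show ?thesis
  proof (cases "CHAR('l) = 0")
    case True
    then have "2 = Suc CHAR('k)" using down antichain_interval_char_0[OF p(1)] by blast
    then show ?thesis using prime_gt_1_nat[OF prime] by simp
  next
    case False
    then have "Suc CHAR('l) = Suc CHAR('k)"
      using down antichain_interval_pos_char[OF L(1) p(1)] by simp
    then show ?thesis by simp
  qed
qed

theorem theorem2p6:
  assumes "infinite (UNIV :: 'k::field set)"
    and "infinite (UNIV :: 'l::field set)"
    and "dirichlet_field TYPE('k)"
    and "dirichlet_field TYPE('l)"
    and "(golomb_topology :: 'k poly topology) homeomorphic_space
         (golomb_topology :: 'l poly topology)"
  shows "CHAR('k) = CHAR('l)"
proof (cases "CHAR('k) = 0")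
  case False
  then show ?thesis using CHAR_eq_if_CHAR_pos[where 'k = 'k and 'l = 'l] assms by simp
next
  case True
  show ?thesis
  proof (rule ccontr)
    assume ne: "CHAR('k) \<noteq> CHAR('l)"
    then have "CHAR('l) > 0" using True by simp
    moreover have "(golomb_topology :: 'l poly topology) homeomorphic_space (golomb_topology :: 'k poly topology)"
      using assms(5) homeomorphic_space_sym by blast
    ultimately show False using CHAR_eq_if_CHAR_pos[where 'k = 'l and 'l = 'k] assms ne by simp
  qed
qed

end
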